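(* Let $T>0$. If $u,p$ are such that $u\in C([0,T);L^2)$ is weakly divergence-free (that is, $u(t)$ is weakly divergence free for each $t$), $p\in L^1_{loc}(\mathbb{R}^3\times[0,T))$, and $$\int_0^T\!\!\int_{\mathbb{R}^3}\big((\phi_t+\Delta\phi)\cdot u+p\,\operatorname{div}\phi\big)\,dx\,dt=0$$ for all $\phi\in C_0^\infty(\mathbb{R}^3\times[0,T);\mathbb{R}^3)$, then $u\equiv0$.
   Context: $L^2=L^2(\mathbb{R}^3;\mathbb{R}^3)$. A vector field $v$ on $\mathbb{R}^3$ is weakly divergence free if $\int_{\mathbb{R}^3}v\cdot\nabla g=0$ for all $g\in C_0^\infty(\mathbb{R}^3)$. Test functions $\phi\in C_0^\infty(\mathbb{R}^3\times[0,T);\mathbb{R}^3)$ are compactly supported in $\mathbb{R}^3\times[0,T)$ and need not vanish at $t=0$. *)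

theory Defs
  imports "HOL-Analysis.Analysis"
begin

text \<open>
  Elements of Lebesgue spaces are represented by functions, with identification almost
  everywhere made explicit where it matters.
\<close>

definition L2 :: "('a::euclidean_space \<Rightarrow> 'b::euclidean_space) set" where
  "L2 = {f. f \<in> borel_measurable lebesgue \<and> integrable lebesgue (\<lambda>x. (norm (f x))\<^sup>2)}"

definition L2_norm :: "('a::euclidean_space \<Rightarrow> 'b::euclidean_space) \<Rightarrow> real" where
  "L2_norm f = sqrt (LINT x|lebesgue. (norm (f x))\<^sup>2)"

definition continuous_into_L2 ::
    "real set \<Rightarrow> (real \<Rightarrow> 'a::euclidean_space \<Rightarrow> 'b::euclidean_space) \<Rightarrow> bool" where
  "continuous_into_L2 I u \<longleftrightarrow>
     (\<forall>t\<in>I. u t \<in> L2) \<and>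
     (\<forall>t\<in>I. ((\<lambda>s. L2_norm (\<lambda>x. u s x - u t x)) \<longlongrightarrow> 0) (at t within I))"

text \<open>Integrability on a compact \<open>K\<close> includes Lebesgue measurability of \<open>p\<close> on \<open>K\<close>.\<close>

definition L1_loc :: "'a::euclidean_space set \<Rightarrow> ('a \<Rightarrow> real) set" where
  "L1_loc S = {p. \<forall>K. compact K \<and> K \<subseteq> S \<longrightarrow> set_integrable lebesgue K p}"

text \<open>
  \<open>C_k_on k S f\<close>: all iterated directional derivatives of \<open>f\<close> up to order \<open>k\<close> exist and are
  continuous on \<open>S\<close>, in the sense of differentiation within \<open>S\<close>. The set \<open>S\<close> need not be open:
  on a slab such as \<open>UNIV \<times> {0..<T}\<close> the derivatives at time 0 are one-sided. The derivative
  within such a set is unique.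
\<close>

primrec C_k_on ::
    "nat \<Rightarrow> 'a::euclidean_space set \<Rightarrow> ('a \<Rightarrow> 'b::euclidean_space) \<Rightarrow> bool" where
  "C_k_on 0 S f = continuous_on S f"
| "C_k_on (Suc k) S f =
     (\<exists>f'. (\<forall>x\<in>S. (f has_derivative f' x) (at x within S)) \<and>
           (\<forall>v. C_k_on k S (\<lambda>x. f' x v)))"

definition smooth_within ::
    "'a::euclidean_space set \<Rightarrow> ('a \<Rightarrow> 'b::euclidean_space) \<Rightarrow> bool" where
  "smooth_within S f \<longleftrightarrow> (\<forall>k. C_k_on k S f)"

text \<open>
  \<open>C\<^sub>0\<^sup>\<infinity>(S)\<close>. Only the values on \<open>S\<close> matter. The support is the closure, in the whole space, of
  the nonvanishing set; requiring it to be a compact subset of \<open>S\<close> imposes no vanishing on the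
  part of the boundary of \<open>S\<close> that belongs to \<open>S\<close>.
\<close>

definition test_functions ::
    "'a::euclidean_space set \<Rightarrow> ('a \<Rightarrow> 'b::euclidean_space) set" where
  "test_functions S =
     {f. smooth_within S f \<and>
         compact (closure {x\<in>S. f x \<noteq> 0}) \<and> closure {x\<in>S. f x \<noteq> 0} \<subseteq> S}"

definition partial_deriv ::
    "'n::finite \<Rightarrow> (real^'n \<Rightarrow> 'b::real_normed_vector) \<Rightarrow> real^'n \<Rightarrow> 'b" where
  "partial_deriv i f x = frechet_derivative f (at x) (axis i 1)"

definition gradient :: "(real^'n::finite \<Rightarrow> real) \<Rightarrow> real^'n \<Rightarrow> real^'n" where
  "gradient g x = (\<chi> i. partial_deriv i g x)"

definition divergence :: "(real^'n::finite \<Rightarrow> real^'n) \<Rightarrow> real^'n \<Rightarrow> real" where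
  "divergence f x = (\<Sum>i\<in>UNIV. partial_deriv i (\<lambda>y. f y $ i) x)"

definition laplacian ::
    "(real^'n::finite \<Rightarrow> 'b::real_normed_vector) \<Rightarrow> real^'n \<Rightarrow> 'b" where
  "laplacian f x = (\<Sum>i\<in>UNIV. partial_deriv i (partial_deriv i f) x)"

definition weakly_divergence_free :: "(real^'n::finite \<Rightarrow> real^'n) \<Rightarrow> bool" where
  "weakly_divergence_free v \<longleftrightarrow>
     (\<forall>g\<in>test_functions UNIV. (LINT x|lebesgue. v x \<bullet> gradient g x) = 0)"

end

theory Submission
  imports Defs
begin

text \<open>
  The pressure is invisible to divergence-free test fields. For such a field \<open>B\<close> on space, the
  function \<open>W y t = \<integral> u t x \<bullet> B (x - y) dx\<close> is a bounded classical solution of the heat equation,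
  and it vanishes at time 0 because the test functions need not vanish there. The maximum principle,
  applied to \<open>W\<close> minus a small multiple of \<open>|y|\<^sup>2 + 7 t\<close> in dimension 3, gives \<open>W = 0\<close>.
  Taking \<open>B = (\<Delta>g) e\<^sub>i - \<nabla>\<partial>\<^sub>i g\<close>
  and using that \<open>u t\<close> is orthogonal to gradients, each component of \<open>u t\<close> is weakly harmonic;
  its correlations with \<open>g\<close> are harmonic and vanish at infinity, hence are zero. Letting \<open>g\<close>
  increase to the indicator of a box yields \<open>u t = 0\<close>.

  Only products \<open>g\<close> of one-variable bumps are needed, so all partial derivatives are explicit and
  their symmetry is immediate.
\<close>

section \<open>Smooth bumps on the line\<close>

text \<open>Two obstacles shape the proof. \<open>u t\<close> is only square integrable, so every
  derivative has to fall on a kernel: the test fields are \<theta>(t) B(x - y), and the maximum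
  principles ask only for limits of second difference quotients, which dominated convergence moves
  from W onto B. The pressure comes without decay or sign, so it cannot be estimated and has to be
  cancelled pointwise. The price is that divergence-free fields see \<open>u t\<close> only up to
  gradients; the missing information is the divergence constraint on \<open>u t\<close>, because
  (\<Delta>g) e_i is the sum of B and the gradient of \<partial>_i g. Since |y|^2 has Laplacian 6 in
  dimension 3, the function |y|^2 + 7 t is a strict supersolution, with surplus 1, and it dominates
  every bounded W far out. Smoothness is carried as data, namely the sequence or family of all
  derivatives, instead of as a property of a single function.\<close>

definition derivative_sequence :: "(nat \<Rightarrow> real \<Rightarrow> real) \<Rightarrow> bool" where
  "derivative_sequence \<beta> \<longleftrightarrow> (\<forall>k s. (\<beta> k has_real_derivative \<beta> (Suc k) s) (at s))"

definition bump_sequence :: "real \<Rightarrow> real \<Rightarrow> (nat \<Rightarrow> real \<Rightarrow> real) \<Rightarrow> bool" where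
  "bump_sequence a b \<beta> \<longleftrightarrow> derivative_sequence \<beta> \<and> (\<forall>k s. s \<notin> {a..b} \<longrightarrow> \<beta> k s = 0)"

text \<open>One term of the exponential series is at most the whole sum. With x = 1/q this makes
  exp(-1/q) beat any power of 1/q, which flattens the bumps at their ends.\<close>

lemma power_mult_exp_minus_le:
  fixes x :: real
  assumes "x > 0"
  shows "x ^ n * exp (- x) \<le> fact n"
proof -
  have "x ^ n / fact n \<le> exp x"
  proof -
    have "(\<Sum>k\<in>{n}. x ^ k /\<^sub>R fact k) \<le> (\<Sum>k. x ^ k /\<^sub>R fact k)"
      using assms by (intro sum_le_suminf summable_exp_generic) auto
    then show ?thesis by (simp add: exp_def divide_inverse mult.commute)
  qed
  then show ?thesis by (simp add: exp_minus field_simps)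
qed

text \<open>The difference quotient at \<open>s\<close> is at most \<open>g x\<close> times |x - s|.
  The factor \<open>g\<close> takes up the numerator polynomial and the cofactor of the root of
  \<open>w\<close>, so it only has to be continuous at \<open>s\<close>.\<close>

lemma has_real_derivative_zero_of_square_bound:
  fixes f g :: "real \<Rightarrow> real"
  assumes "isCont g s" and "\<And>x. \<bar>f x\<bar> \<le> g x * (x - s)\<^sup>2"
  shows "(f has_real_derivative 0) (at s)"
proof -
  have fs: "f s = 0" using assms(2)[of s] by simp
  have "((\<lambda>x. g x * \<bar>x - s\<bar>) \<longlongrightarrow> g s * \<bar>s - s\<bar>) (at s)"
    using assms(1) unfolding isCont_def by (intro tendsto_intros)
  then have lim: "((\<lambda>x. g x * \<bar>x - s\<bar>) \<longlongrightarrow> 0) (at s)" by simp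
  have "\<forall>\<^sub>F x in at s. norm ((f x - f s) / (x - s)) \<le> g x * \<bar>x - s\<bar>"
  proof (rule eventually_at_filter[THEN iffD2], rule always_eventually, intro allI impI)
    fix x assume "x \<noteq> s"
    then have "\<bar>x - s\<bar> > 0" by simp
    moreover have "\<bar>f x\<bar> \<le> (g x * \<bar>x - s\<bar>) * \<bar>x - s\<bar>"
      using assms(2)[of x] by (metis mult.assoc power2_abs power2_eq_square)
    ultimately show "norm ((f x - f s) / (x - s)) \<le> g x * \<bar>x - s\<bar>"
      using fs by (simp add: pos_divide_le_eq)
  qed
  then have "((\<lambda>x. (f x - f s) / (x - s)) \<longlongrightarrow> 0) (at s)"
    by (rule Lim_null_comparison[OF _ lim])
  then show ?thesis by (simp add: has_field_derivative_iff)
qed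

text \<open>The \<open>k\<close>-th derivative of \<open>exp (- 1 / w)\<close> is \<open>exp_inverse_numerator w k / w ^ (2 * k)\<close> times
  \<open>exp (- 1 / w)\<close>.\<close>

primrec exp_inverse_numerator :: "real poly \<Rightarrow> nat \<Rightarrow> real poly" where
  "exp_inverse_numerator w 0 = 1"
| "exp_inverse_numerator w (Suc k) =
     pderiv (exp_inverse_numerator w k) * w\<^sup>2
     - smult (2 * real k) (exp_inverse_numerator w k * pderiv w * w)
     + exp_inverse_numerator w k * pderiv w"

definition exp_inverse_bump :: "real poly \<Rightarrow> nat \<Rightarrow> real \<Rightarrow> real" where
  "exp_inverse_bump w k s =
     (if poly w s > 0
      then poly (exp_inverse_numerator w k) s / poly w s ^ (2 * k) * exp (- (1 / poly w s)) else 0)"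

text \<open>The exponent 2k + 2 is spent as 2k powers that cancel the denominator and two more that
  leave the square of \<open>poly w s\<close>, the flatness needed at a zero of
  \<open>w\<close>.\<close>

lemma exp_inverse_bump_bound:
  "\<bar>exp_inverse_bump w k s\<bar>
     \<le> \<bar>poly (exp_inverse_numerator w k) s\<bar> * fact (2 * k + 2) * (poly w s)\<^sup>2"
proof (cases "poly w s > 0")
  case True
  define q where "q = poly w s"
  have q: "q > 0" using True by (simp add: q_def)
  have "(1/q) ^ (2 * k + 2) * exp (- (1/q)) \<le> fact (2 * k + 2)"
    by (rule power_mult_exp_minus_le) (use q in simp)
  then have "exp (- (1/q)) / q ^ (2 * k) \<le> fact (2 * k + 2) * q\<^sup>2"
    using q by (simp add: power_add power_divide field_simps power2_eq_square)
  then have "\<bar>poly (exp_inverse_numerator w k) s\<bar> * (exp (- (1/q)) / q ^ (2 * k))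
     \<le> \<bar>poly (exp_inverse_numerator w k) s\<bar> * (fact (2 * k + 2) * q\<^sup>2)"
    by (rule mult_left_mono) simp
  then show ?thesis
    using True q by (simp add: exp_inverse_bump_def abs_mult q_def mult_ac)
qed (simp add: exp_inverse_bump_def)

text \<open>Where \<open>w\<close> is positive, the recursion for the numerators is the quotient
  rule; where it is negative, everything is locally 0. At a zero the two formulas meet and the
  flatness bound decides.\<close>

lemma derivative_sequence_exp_inverse_bump: "derivative_sequence (exp_inverse_bump w)"
  unfolding derivative_sequence_def
proof (intro allI)
  fix k s
  let ?P = "exp_inverse_numerator w k"
  have cont: "isCont (poly q) x" for q :: "real poly" and x by simp
  consider (pos) "poly w s > 0" | (neg) "poly w s < 0" | (zero) "poly w s = 0" by linarith
  then show "(exp_inverse_bump w k has_real_derivative exp_inverse_bump w (Suc k) s) (at s)"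
  proof cases
    case pos
    have ev: "\<forall>\<^sub>F x in nhds s. exp_inverse_bump w k x
        = poly ?P x / poly w x ^ (2 * k) * exp (- (1 / poly w x))"
    proof -
      have "\<forall>\<^sub>F x in nhds s. poly w x > 0"
        using cont[of s w] pos by (metis order_tendstoD(1) isCont_def tendsto_at_iff_tendsto_nhds)
      then show ?thesis by eventually_elim (simp add: exp_inverse_bump_def)
    qed
    have w0: "poly w s \<noteq> 0" using pos by simp
    have E: "((\<lambda>x. poly ?P x / poly w x ^ (2 * k) * exp (- (1 / poly w x)))
        has_real_derivative exp_inverse_bump w (Suc k) s) (at s)"
    proof -
      define n where "n = 2 * k"
      define e where "e = exp (- (1 / poly w s))"
      define q where "q = poly w s ^ n"
      define a where "a = poly w s"
      have a0: "a \<noteq> 0" and q0: "q \<noteq> 0" using w0 by (simp_all add: a_def q_def)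
      have D1: "((\<lambda>x. poly w x ^ n) has_real_derivative real n * q * poly (pderiv w) s / a) (at s)"
      proof (rule DERIV_cong[OF DERIV_power[OF poly_DERIV]])
        show "real n * (poly (pderiv w) s * poly w s ^ (n - Suc 0)) = real n * q * poly (pderiv w) s / a"
          using a0 by (cases n) (simp_all add: q_def a_def)
      qed
      have D2: "((\<lambda>x. exp (- (1 / poly w x))) has_real_derivative e * (poly (pderiv w) s / a\<^sup>2)) (at s)"
        unfolding e_def a_def by (rule derivative_eq_intros poly_DERIV refl w0)+
          (simp add: power2_eq_square)
      have D3: "((\<lambda>x. poly ?P x / poly w x ^ n * exp (- (1 / poly w x))) has_real_derivative
          (poly (pderiv ?P) s * q - poly ?P s * (real n * q * poly (pderiv w) s / a)) / (q * q) * e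
          + e * (poly (pderiv w) s / a\<^sup>2) * (poly ?P s / q)) (at s)"
        using DERIV_mult[OF DERIV_divide[OF poly_DERIV D1] D2] w0
        unfolding q_def[symmetric] e_def[symmetric] by (simp add: q_def)
      have P: "poly (exp_inverse_numerator w (Suc k)) s
        = poly (pderiv ?P) s * a\<^sup>2 - real n * (poly ?P s * poly (pderiv w) s * a)
          + poly ?P s * poly (pderiv w) s"
        by (simp add: a_def n_def)
      have "exp_inverse_bump w (Suc k) s = poly (exp_inverse_numerator w (Suc k)) s / (a\<^sup>2 * q) * e"
        using pos by (simp add: exp_inverse_bump_def a_def q_def e_def n_def power2_eq_square)
      also have "\<dots> = (poly (pderiv ?P) s * q - poly ?P s * (real n * q * poly (pderiv w) s / a)) / (q * q) * e
          + e * (poly (pderiv w) s / a\<^sup>2) * (poly ?P s / q)"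
        unfolding P using a0 q0 by (simp add: divide_simps power2_eq_square) (simp add: algebra_simps)
      finally show ?thesis using D3 by (simp add: n_def)
    qed
    show ?thesis using E DERIV_cong_ev[OF refl ev refl] by blast
  next
    case neg
    have "\<forall>\<^sub>F x in nhds s. poly w x < 0"
      using cont[of s w] neg by (metis order_tendstoD(2) isCont_def tendsto_at_iff_tendsto_nhds)
    then have ev: "\<forall>\<^sub>F x in nhds s. exp_inverse_bump w k x = 0"
      by eventually_elim (simp add: exp_inverse_bump_def)
    have "((\<lambda>x. 0) has_real_derivative exp_inverse_bump w (Suc k) s) (at s)"
      using neg by (simp add: exp_inverse_bump_def)
    then show ?thesis using DERIV_cong_ev[OF refl ev refl] by blast
  next
    case zero
    \<comment> \<open>A linear factor of \<open>w\<close> turns the bound in \<open>w\<close> into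
      one in (x - s)^2. Every multiplicity of the zero is covered, and \<open>w = 0\<close> with
      \<open>r = 0\<close>.\<close>
    then obtain r where r: "w = [:- s, 1:] * r" using poly_eq_0_iff_dvd by blast
    have "(exp_inverse_bump w k has_real_derivative 0) (at s)"
    proof (rule has_real_derivative_zero_of_square_bound)
      show "isCont (\<lambda>x. \<bar>poly ?P x\<bar> * fact (2 * k + 2) * (poly r x)\<^sup>2) s"
        by (intro continuous_intros)
      show "\<bar>exp_inverse_bump w k x\<bar>
          \<le> \<bar>poly ?P x\<bar> * fact (2 * k + 2) * (poly r x)\<^sup>2 * (x - s)\<^sup>2" for x
      proof -
        have "poly w x = (x - s) * poly r x" by (simp add: r algebra_simps)
        then have "(poly w x)\<^sup>2 = (poly r x)\<^sup>2 * (x - s)\<^sup>2" by (simp add: power_mult_distrib)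
        then show ?thesis using exp_inverse_bump_bound[of w k x] by (simp add: mult.assoc)
      qed
    qed
    then show ?thesis using zero by (simp add: exp_inverse_bump_def)
  qed
qed

text \<open>For \<open>c > 0\<close> and \<open>a < b\<close> the quadratic q is positive exactly on
  the open interval. The factor \<open>c\<close> is a sharpness: as it grows, exp(-1/(c q)) tends to
  1 at every inner point, so the bump tends to the indicator of the open interval.\<close>

definition interval_bump :: "real \<Rightarrow> real \<Rightarrow> real \<Rightarrow> nat \<Rightarrow> real \<Rightarrow> real" where
  "interval_bump c a b = exp_inverse_bump (smult c ([:- a, 1:] * [:b, - 1:]))"

lemma interval_bump_0:
  "interval_bump c a b 0 s =
     (if c * ((s - a) * (b - s)) > 0 then exp (- (1 / (c * ((s - a) * (b - s))))) else 0)"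
  by (simp add: interval_bump_def exp_inverse_bump_def algebra_simps)

lemma interval_bump_range: "interval_bump c a b 0 s \<in> {0..1}"
proof -
  have "exp_inverse_bump w 0 s \<in> {0..1}" for w by (simp add: exp_inverse_bump_def)
  then show ?thesis unfolding interval_bump_def .
qed

lemma bump_sequence_interval_bump:
  assumes "c > 0" "a \<le> b"
  shows "bump_sequence a b (interval_bump c a b)"
proof -
  have "poly (smult c ([:- a, 1:] * [:b, - 1:])) s \<le> 0" if "s \<notin> {a..b}" for s
  proof -
    have "(s - a) * (b - s) \<le> 0" using that assms(2)
      by (auto simp: mult_le_0_iff)
    then have "c * ((s - a) * (b - s)) \<le> 0" using assms by (simp add: mult_le_0_iff)
    then show ?thesis by (simp add: algebra_simps)
  qed
  then show ?thesis
    unfolding bump_sequence_def interval_bump_def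
    using derivative_sequence_exp_inverse_bump by (metis exp_inverse_bump_def linorder_not_le)
qed

lemma derivative_sequence_continuous:
  "derivative_sequence \<beta> \<Longrightarrow> continuous_on S (\<beta> k)"
  unfolding derivative_sequence_def
  by (meson DERIV_isCont continuous_at_imp_continuous_on)

section \<open>Test functions from families closed under differentiation\<close>

lemma C_k_on_add:
  "C_k_on n S f \<Longrightarrow> C_k_on n S g \<Longrightarrow> C_k_on n S (\<lambda>x. f x + g x)"
proof (induction n arbitrary: f g)
  case 0
  then show ?case by (simp add: continuous_on_add)
next
  case (Suc n)
  obtain f' g' where
    "\<forall>x\<in>S. (f has_derivative f' x) (at x within S)" "\<forall>v. C_k_on n S (\<lambda>x. f' x v)"
    "\<forall>x\<in>S. (g has_derivative g' x) (at x within S)" "\<forall>v. C_k_on n S (\<lambda>x. g' x v)"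
    using Suc.prems by auto
  then show ?case
    unfolding C_k_on.simps
    by (intro exI[of _ "\<lambda>x v. f' x v + g' x v"]) (auto intro!: has_derivative_add Suc.IH)
qed

lemma C_k_on_scaleR: "C_k_on n S f \<Longrightarrow> C_k_on n S (\<lambda>x. c *\<^sub>R f x)"
proof (induction n arbitrary: f)
  case 0
  then show ?case by (simp add: continuous_on_scaleR)
next
  case (Suc n)
  obtain f' where
    "\<forall>x\<in>S. (f has_derivative f' x) (at x within S)" "\<forall>v. C_k_on n S (\<lambda>x. f' x v)"
    using Suc.prems by auto
  then show ?case
    unfolding C_k_on.simps
    by (intro exI[of _ "\<lambda>x v. c *\<^sub>R f' x v"]) (auto intro!: has_derivative_scaleR_right Suc.IH)
qed

lemma C_k_on_zero: "C_k_on n S (\<lambda>x. 0)"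
proof (induction n)
  case (Suc n)
  then show ?case
    unfolding C_k_on.simps by (intro exI[of _ "\<lambda>x v. 0"]) auto
qed simp

lemma C_k_on_sum:
  assumes "finite E" "\<And>e. e \<in> E \<Longrightarrow> C_k_on n S (f e)"
  shows "C_k_on n S (\<lambda>x. \<Sum>e\<in>E. f e x)"
  using assms by (induction E rule: finite_induct) (auto intro: C_k_on_zero C_k_on_add)

text \<open>A directional derivative of a member is a combination of members whose coefficients do
  not depend on the point. Hence induction on the order, over all indices at once, needs sums and
  constant multiples but no product rule.\<close>

lemma C_k_on_derivative_closed:
  fixes F :: "'i \<Rightarrow> 'a::euclidean_space \<Rightarrow> 'b::euclidean_space"
  assumes "finite E"
    and der: "\<And>i x. x \<in> S \<Longrightarrow>
      (F i has_derivative (\<lambda>v. \<Sum>e\<in>E. c e v *\<^sub>R F (\<sigma> e i) x)) (at x within S)"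
  shows "C_k_on n S (F i)"
proof (induction n arbitrary: i)
  case 0
  then show ?case
    using der has_derivative_continuous by (fastforce simp: continuous_on_eq_continuous_within)
next
  case (Suc n)
  then show ?case
    unfolding C_k_on.simps
    by (intro exI[of _ "\<lambda>x v. \<Sum>e\<in>E. c e v *\<^sub>R F (\<sigma> e i) x"])
       (auto intro!: der C_k_on_sum C_k_on_scaleR assms)
qed

section \<open>Multi-indexed families of partial derivatives\<close>

definition inc :: "'n \<Rightarrow> ('n \<Rightarrow> nat) \<Rightarrow> 'n \<Rightarrow> nat" where
  "inc i k = k(i := Suc (k i))"

text \<open>Indexing by multi-indices, instead of by lists of directions, reduces the symmetry of
  mixed partial derivatives to this identity.\<close>

lemma inc_commute: "inc i (inc j k) = inc j (inc i k)"
  by (auto simp: inc_def)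

text \<open>\<open>A k\<close> is the partial derivative of \<open>A (\<lambda>_. 0)\<close> with multi-index \<open>k\<close>, so smoothness is the
  existence of the whole family.\<close>

definition derivative_family :: "(('n::finite \<Rightarrow> nat) \<Rightarrow> real^'n \<Rightarrow> 'b::real_normed_vector) \<Rightarrow> bool" where
  "derivative_family A \<longleftrightarrow>
     (\<forall>k x. (A k has_derivative (\<lambda>v. \<Sum>j\<in>UNIV. (v $ j) *\<^sub>R A (inc j k) x)) (at x))"

definition supported_on :: "'a set \<Rightarrow> ('i \<Rightarrow> 'a \<Rightarrow> 'b::zero) \<Rightarrow> bool" where
  "supported_on K A \<longleftrightarrow> (\<forall>k x. x \<notin> K \<longrightarrow> A k x = 0)"

lemma partial_deriv_family:
  assumes "derivative_family A"
  shows "partial_deriv i (A k) = A (inc i k)"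
proof
  fix x
  have "(A k has_derivative (\<lambda>v. \<Sum>j\<in>UNIV. (v $ j) *\<^sub>R A (inc j k) x)) (at x)"
    using assms by (simp add: derivative_family_def)
  then have "frechet_derivative (A k) (at x) = (\<lambda>v. \<Sum>j\<in>UNIV. (v $ j) *\<^sub>R A (inc j k) x)"
    by (rule frechet_derivative_at[symmetric])
  then show "partial_deriv i (A k) x = A (inc i k) x"
    by (simp add: partial_deriv_def axis_def if_distrib[of "\<lambda>r. r *\<^sub>R _"] cong: if_cong)
qed

lemma laplacian_family:
  assumes "derivative_family A"
  shows "laplacian (A k) x = (\<Sum>i\<in>UNIV. A (inc i (inc i k)) x)"
  by (simp add: laplacian_def partial_deriv_family[OF assms])

lemma derivative_family_scaleR:
  assumes "derivative_family A"
  shows "derivative_family (\<lambda>k x. c *\<^sub>R A k x)"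
  unfolding derivative_family_def
proof (intro allI)
  fix k x
  have "((\<lambda>x. c *\<^sub>R A k x) has_derivative
      (\<lambda>v. c *\<^sub>R (\<Sum>j\<in>UNIV. (v $ j) *\<^sub>R A (inc j k) x))) (at x)"
    using assms unfolding derivative_family_def by (intro has_derivative_scaleR_right) blast
  then show "((\<lambda>x. c *\<^sub>R A k x) has_derivative
      (\<lambda>v. \<Sum>j\<in>UNIV. (v $ j) *\<^sub>R c *\<^sub>R A (inc j k) x)) (at x)"
    by (simp add: scaleR_sum_right mult.commute)
qed

lemma derivative_family_add:
  assumes "derivative_family A" "derivative_family B"
  shows "derivative_family (\<lambda>k x. A k x + B k x)"
  unfolding derivative_family_def
proof (intro allI)
  fix k x
  have "((\<lambda>x. A k x + B k x) has_derivative
      (\<lambda>v. (\<Sum>j\<in>UNIV. (v $ j) *\<^sub>R A (inc j k) x) + (\<Sum>j\<in>UNIV. (v $ j) *\<^sub>R B (inc j k) x))) (at x)"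
    using assms unfolding derivative_family_def by (intro has_derivative_add) blast+
  then show "((\<lambda>x. A k x + B k x) has_derivative
      (\<lambda>v. \<Sum>j\<in>UNIV. (v $ j) *\<^sub>R (A (inc j k) x + B (inc j k) x))) (at x)"
    by (simp add: sum.distrib scaleR_right_distrib)
qed

lemma derivative_family_sum:
  assumes "finite E" "\<And>e. e \<in> E \<Longrightarrow> derivative_family (A e)"
  shows "derivative_family (\<lambda>k x. \<Sum>e\<in>E. A e k x)"
  using assms
proof (induction E rule: finite_induct)
  case empty
  then show ?case by (simp add: derivative_family_def)
next
  case (insert e E)
  then show ?case using derivative_family_add[of "A e" "\<lambda>k x. \<Sum>e\<in>E. A e k x"] by simp
qed

lemma derivative_family_inc:
  "derivative_family A \<Longrightarrow> derivative_family (\<lambda>k. A (inc i k))"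
  by (simp add: derivative_family_def inc_commute[of i])

lemma derivative_family_scaleR_left:
  fixes A :: "('n::finite \<Rightarrow> nat) \<Rightarrow> real^'n \<Rightarrow> real"
  assumes "derivative_family A"
  shows "derivative_family (\<lambda>k x. A k x *\<^sub>R (w :: 'b::real_normed_vector))"
  unfolding derivative_family_def
proof (intro allI)
  fix k x
  have "((\<lambda>x. A k x *\<^sub>R w) has_derivative
      (\<lambda>v. (\<Sum>j\<in>UNIV. (v $ j) *\<^sub>R A (inc j k) x) *\<^sub>R w)) (at x)"
    using assms unfolding derivative_family_def by (intro has_derivative_scaleR_left) blast
  then show "((\<lambda>x. A k x *\<^sub>R w) has_derivative
      (\<lambda>v. \<Sum>j\<in>UNIV. (v $ j) *\<^sub>R A (inc j k) x *\<^sub>R w)) (at x)"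
    by (simp add: scaleR_sum_left)
qed

lemma derivative_family_continuous:
  "derivative_family A \<Longrightarrow> continuous_on S (A k)"
  unfolding derivative_family_def
  by (meson continuous_at_imp_continuous_on has_derivative_continuous)

lemma derivative_family_test_function:
  fixes A :: "('n::finite \<Rightarrow> nat) \<Rightarrow> real^'n \<Rightarrow> 'b::euclidean_space"
  assumes "derivative_family A" "supported_on K A" "compact K"
  shows "A k \<in> test_functions UNIV"
proof -
  have "C_k_on n UNIV (A k)" for n
    using assms(1) unfolding derivative_family_def
    by (intro C_k_on_derivative_closed[where E = UNIV and \<sigma> = inc and c = "\<lambda>j v. v $ j"]) auto
  moreover have sub: "closure {x\<in>UNIV. A k x \<noteq> 0} \<subseteq> K"
    using assms by (intro closure_minimal) (auto simp: supported_on_def compact_imp_closed)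
  then have "compact (closure {x\<in>UNIV. A k x \<noteq> 0})"
    using assms(3) unfolding compact_eq_bounded_closed by (blast intro: bounded_subset)
  ultimately show ?thesis by (simp add: test_functions_def smooth_within_def)
qed

text \<open>Nothing is asked of \<open>\<theta>\<close> near time 0: the slab contains its bottom,
  so the compact set \<open>K \<times> {0..c}\<close> lies inside it as soon as
  \<open>c < T\<close>. This freedom is what later forces the initial value 0.\<close>

lemma separated_test_function:
  fixes A :: "('n::finite \<Rightarrow> nat) \<Rightarrow> real^'n \<Rightarrow> 'b::euclidean_space"
  assumes A: "derivative_family A" "supported_on K A" "compact K"
    and \<theta>: "derivative_sequence \<theta>" "\<And>t. t \<ge> c \<Longrightarrow> \<theta> 0 t = 0" and "c < T"
  shows "(\<lambda>z. \<theta> 0 (snd z) *\<^sub>R A k (fst z)) \<in> test_functions (UNIV \<times> {0..<T})"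
proof -
  define S where "S = (UNIV \<times> {0..<T} :: ((real^'n) \<times> real) set)"
  define F where "F = (\<lambda>(m, k) z. \<theta> m (snd z) *\<^sub>R A k (fst z))"
  \<comment> \<open>Directions of space-time are indexed by \<open>option\<close>:
    \<open>None\<close> is time and \<open>Some j\<close> is the j-th space direction.\<close>
  define \<sigma> :: "'n option \<Rightarrow> nat \<times> ('n \<Rightarrow> nat) \<Rightarrow> nat \<times> ('n \<Rightarrow> nat)" where
    "\<sigma> = (\<lambda>e (m, k). case e of None \<Rightarrow> (Suc m, k) | Some j \<Rightarrow> (m, inc j k))"
  define c' :: "'n option \<Rightarrow> (real^'n) \<times> real \<Rightarrow> real" where
    "c' = (\<lambda>e v. case e of None \<Rightarrow> snd v | Some j \<Rightarrow> fst v $ j)"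
  have der: "(F i has_derivative (\<lambda>v. \<Sum>e\<in>UNIV. c' e v *\<^sub>R F (\<sigma> e i) z)) (at z within S)" for i z
  proof -
    obtain m k where i: "i = (m, k)" by (cases i)
    have "(A k has_derivative (\<lambda>v. \<Sum>j\<in>UNIV. (v $ j) *\<^sub>R A (inc j k) (fst z))) (at (fst z))"
      using A(1) by (simp add: derivative_family_def)
    from has_derivative_compose[OF has_derivative_fst[OF has_derivative_ident] this]
    have dA: "((\<lambda>z. A k (fst z)) has_derivative
        (\<lambda>v. \<Sum>j\<in>UNIV. (fst v $ j) *\<^sub>R A (inc j k) (fst z))) (at z within S)" .
    have "(\<theta> m has_derivative (\<lambda>v. \<theta> (Suc m) (snd z) * v)) (at (snd z))"
      using \<theta>(1) by (simp add: derivative_sequence_def has_field_derivative_def)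
    from has_derivative_compose[OF has_derivative_snd[OF has_derivative_ident] this]
    have dt: "((\<lambda>z. \<theta> m (snd z)) has_derivative (\<lambda>v. \<theta> (Suc m) (snd z) * snd v)) (at z within S)" .
    have "(\<lambda>v. \<Sum>e\<in>UNIV. c' e v *\<^sub>R F (\<sigma> e i) z) =
        (\<lambda>v. \<theta> m (snd z) *\<^sub>R (\<Sum>j\<in>UNIV. (fst v $ j) *\<^sub>R A (inc j k) (fst z))
           + (\<theta> (Suc m) (snd z) * snd v) *\<^sub>R A k (fst z))"
      by (simp add: UNIV_option_conv sum.reindex F_def \<sigma>_def c'_def i scaleR_sum_right mult_ac add_ac)
    then show ?thesis
      using has_derivative_scaleR[OF dt dA] by (simp add: F_def i)
  qed
  have smooth: "C_k_on n S (F (0, k))" for n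
    by (rule C_k_on_derivative_closed[where E = UNIV, OF _ der]) simp
  have Feq: "F (0, k) = (\<lambda>z. \<theta> 0 (snd z) *\<^sub>R A k (fst z))" by (simp add: F_def)
  have "{z\<in>S. F (0, k) z \<noteq> 0} \<subseteq> K \<times> {0..c}"
    using A(2) \<theta>(2) by (fastforce simp: S_def F_def supported_on_def)
  then have sub: "closure {z\<in>S. F (0, k) z \<noteq> 0} \<subseteq> K \<times> {0..c}"
    using A(3) by (intro closure_minimal) (auto intro!: closed_Times simp: compact_imp_closed)
  have "compact (K \<times> {0..c})" using A(3) by (intro compact_Times) auto
  then have "compact (closure {z\<in>S. F (0, k) z \<noteq> 0})"
    using sub unfolding compact_eq_bounded_closed by (blast intro: bounded_subset)
  moreover have "K \<times> {0..c} \<subseteq> S" using \<open>c < T\<close> by (auto simp: S_def)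
  ultimately show ?thesis
    using smooth sub unfolding Feq S_def test_functions_def smooth_within_def by auto
qed

section \<open>Products of one-variable bumps and the divergence-free fields built from a
  family\<close>

definition tensor_product :: "('n::finite \<Rightarrow> nat \<Rightarrow> real \<Rightarrow> real) \<Rightarrow> ('n \<Rightarrow> nat) \<Rightarrow> real^'n \<Rightarrow> real" where
  "tensor_product \<beta> k x = (\<Prod>j\<in>UNIV. \<beta> j (k j) (x $ j))"

lemma derivative_family_tensor_product:
  fixes \<beta> :: "'n::finite \<Rightarrow> nat \<Rightarrow> real \<Rightarrow> real"
  assumes "\<And>j. derivative_sequence (\<beta> j)"
  shows "derivative_family (tensor_product \<beta>)"
  unfolding derivative_family_def
proof (intro allI)
  fix k and x :: "real^'n"
  have "((\<lambda>x. \<beta> j (k j) (x $ j)) has_derivative (\<lambda>v. \<beta> j (Suc (k j)) (x $ j) * v $ j)) (at x)" for j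
  proof -
    have "(\<beta> j (k j) has_derivative (\<lambda>v. \<beta> j (Suc (k j)) (x $ j) * v)) (at (x $ j))"
      using assms by (simp add: derivative_sequence_def has_field_derivative_def)
    from has_derivative_compose[OF bounded_linear.has_derivative[OF bounded_linear_vec_nth has_derivative_ident] this]
    show ?thesis .
  qed
  then have "(tensor_product \<beta> k has_derivative
    (\<lambda>v. \<Sum>i\<in>UNIV. \<beta> i (Suc (k i)) (x $ i) * v $ i * (\<Prod>j\<in>UNIV - {i}. \<beta> j (k j) (x $ j)))) (at x)"
    unfolding tensor_product_def by (intro has_derivative_prod) auto
  moreover have "\<beta> i (Suc (k i)) (x $ i) * v $ i * (\<Prod>j\<in>UNIV - {i}. \<beta> j (k j) (x $ j))
      = v $ i *\<^sub>R tensor_product \<beta> (inc i k) x" for i and v :: "real^'n"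
  proof -
    have "tensor_product \<beta> (inc i k) x
      = \<beta> i (inc i k i) (x $ i) * (\<Prod>j\<in>UNIV - {i}. \<beta> j (inc i k j) (x $ j))"
      unfolding tensor_product_def by (subst prod.remove[of _ i]) auto
    also have "(\<Prod>j\<in>UNIV - {i}. \<beta> j (inc i k j) (x $ j)) = (\<Prod>j\<in>UNIV - {i}. \<beta> j (k j) (x $ j))"
      by (rule prod.cong) (auto simp: inc_def)
    also have "inc i k i = Suc (k i)" by (simp add: inc_def)
    finally show ?thesis by (simp add: mult_ac)
  qed
  ultimately show "(tensor_product \<beta> k has_derivative
      (\<lambda>v. \<Sum>j\<in>UNIV. v $ j *\<^sub>R tensor_product \<beta> (inc j k) x)) (at x)"
    by simp
qed

lemma supported_on_tensor_product:
  assumes "\<And>j. bump_sequence (a $ j) (b $ j) (\<beta> j)"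
  shows "supported_on (cbox a b) (tensor_product \<beta>)"
  unfolding supported_on_def tensor_product_def
proof (intro allI impI)
  fix k x assume "x \<notin> cbox a b"
  then obtain j where "x $ j \<notin> {a $ j..b $ j}" by (auto simp: mem_box_cart)
  then have "\<beta> j (k j) (x $ j) = 0" using assms by (simp add: bump_sequence_def)
  then show "(\<Prod>j\<in>UNIV. \<beta> j (k j) (x $ j)) = 0" by (meson UNIV_I finite prod_zero)
qed

text \<open>For scalar \<open>g\<close>, the field \<open>(\<Delta>g) e\<^sub>i - \<nabla>\<partial>\<^sub>i g\<close> (that is, \<open>- curl curl (g e\<^sub>i)\<close> in
  dimension 3) is divergence free.\<close>

definition solenoidal_field ::
    "'n \<Rightarrow> (('n::finite \<Rightarrow> nat) \<Rightarrow> real^'n \<Rightarrow> real) \<Rightarrow> ('n \<Rightarrow> nat) \<Rightarrow> real^'n \<Rightarrow> real^'n" where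
  "solenoidal_field i A k x =
     (\<Sum>j\<in>UNIV. A (inc j (inc j k)) x *\<^sub>R axis i 1 + (- 1) *\<^sub>R (A (inc i (inc j k)) x *\<^sub>R axis j 1))"

lemma derivative_family_solenoidal_field:
  assumes "derivative_family A"
  shows "derivative_family (solenoidal_field i A)"
  unfolding solenoidal_field_def[abs_def] using assms
  by (intro derivative_family_sum derivative_family_add derivative_family_scaleR derivative_family_scaleR_left
      derivative_family_inc[where A = "\<lambda>k. A (inc _ k)"] derivative_family_inc) auto

lemma supported_on_solenoidal_field:
  "supported_on K A \<Longrightarrow> supported_on K (solenoidal_field i A)"
  by (simp add: supported_on_def solenoidal_field_def)

lemma solenoidal_field_component:
  "solenoidal_field i A k x $ l =
     (if l = i then \<Sum>j\<in>UNIV. A (inc j (inc j k)) x else 0) - A (inc i (inc l k)) x"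
proof -
  have "solenoidal_field i A k x $ l =
     (\<Sum>j\<in>UNIV. A (inc j (inc j k)) x * (if l = i then 1 else 0)) -
     (\<Sum>j\<in>UNIV. A (inc i (inc j k)) x * (if l = j then 1 else 0))"
    by (simp add: solenoidal_field_def axis_def sum_subtractf if_distrib cong: if_cong)
  then show ?thesis by (simp add: if_distrib cong: if_cong)
qed

text \<open>The two terms contribute \<partial>_i \<Delta> and \<Delta> \<partial>_i of
  \<open>A k\<close>, equal once indices commute. The factor \<open>c\<close> is carried because a
  time slice of the test field is a multiple \<theta>(t) of its spatial part.\<close>

lemma divergence_solenoidal_field:
  assumes A: "derivative_family A"
  shows "divergence (\<lambda>y. c *\<^sub>R solenoidal_field i A k y) x = 0"
proof -
  have fam: "derivative_family (\<lambda>k y. c *\<^sub>R (solenoidal_field i A k y $ l))" for l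
  proof (cases "l = i")
    case True
    have "derivative_family (\<lambda>k x. c *\<^sub>R ((\<Sum>j\<in>UNIV. A (inc j (inc j k)) x) + (- 1) *\<^sub>R A (inc i (inc l k)) x))"
      using A by (intro derivative_family_sum derivative_family_add derivative_family_scaleR
          derivative_family_inc[where A = "\<lambda>k. A (inc _ k)"] derivative_family_inc) auto
    then show ?thesis using True by (simp add: solenoidal_field_component)
  next
    case False
    have "derivative_family (\<lambda>k x. c *\<^sub>R ((- 1) *\<^sub>R A (inc i (inc l k)) x))"
      using A by (intro derivative_family_scaleR
          derivative_family_inc[where A = "\<lambda>k. A (inc _ k)"] derivative_family_inc) auto
    then show ?thesis using False by (simp add: solenoidal_field_component)
  qed
  have "divergence (\<lambda>y. c *\<^sub>R solenoidal_field i A k y) x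
      = (\<Sum>l\<in>UNIV. c *\<^sub>R (solenoidal_field i A (inc l k) x $ l))"
    unfolding divergence_def vector_scaleR_component
    by (simp add: partial_deriv_family[OF fam, unfolded real_scaleR_def])
  also have "\<dots> = c * ((\<Sum>j\<in>UNIV. A (inc j (inc j (inc i k))) x) - (\<Sum>l\<in>UNIV. A (inc i (inc l (inc l k))) x))"
    by (simp add: solenoidal_field_component sum_distrib_left sum_subtractf right_diff_distrib
        if_distrib[of "\<lambda>r. c * r"] cong: if_cong)
  also have "\<dots> = 0" by (simp add: inc_commute[of i])
  finally show ?thesis .
qed

section \<open>Maximum principles\<close>

text \<open>A discrete Laplacian with step \<open>h\<close>. Its limit replaces the Laplacian in
  both maximum principles, so correlations never have to be shown twice differentiable.\<close>

definition second_difference_sum :: "(real^'n::finite \<Rightarrow> real) \<Rightarrow> real^'n \<Rightarrow> real \<Rightarrow> real" where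
  "second_difference_sum f y h =
     (\<Sum>i\<in>UNIV. f (y + h *\<^sub>R axis i 1) + f (y - h *\<^sub>R axis i 1) - 2 * f y) / h\<^sup>2"

text \<open>At a local maximum of f - \<epsilon> |.|^2, a second difference of f is at most
  \<epsilon> times that of |.|^2, which is exactly 2 h^2 by the parallelogram law. The sign of
  \<epsilon> is free: the heat equation uses a positive value, the harmonic case a negative
  one.\<close>

lemma second_difference_sum_limit_at_max:
  fixes f :: "real^'n::finite \<Rightarrow> real"
  assumes lim: "(second_difference_sum f y \<longlongrightarrow> L) (at_right 0)"
    and "r > 0"
    and max: "\<And>z. dist z y < r \<Longrightarrow> f z - \<epsilon> * (norm z)\<^sup>2 \<le> f y - \<epsilon> * (norm y)\<^sup>2"
  shows "L \<le> 2 * \<epsilon> * CARD('n)"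
proof (rule tendsto_upperbound[OF lim])
  have "\<forall>\<^sub>F h in at_right 0. h \<in> {0<..<r}"
    using \<open>r > 0\<close> by (rule eventually_at_right_real)
  then show "\<forall>\<^sub>F h in at_right 0. second_difference_sum f y h \<le> 2 * \<epsilon> * CARD('n)"
  proof eventually_elim
    case (elim h)
    have "f (y + h *\<^sub>R axis i 1) + f (y - h *\<^sub>R axis i 1) - 2 * f y \<le> 2 * \<epsilon> * h\<^sup>2" for i
    proof -
      let ?e = "h *\<^sub>R axis i 1 :: real^'n"
      have "(norm (y + ?e))\<^sup>2 + (norm (y - ?e))\<^sup>2 = 2 * (norm y)\<^sup>2 + 2 * h\<^sup>2"
        unfolding power2_norm_eq_inner
        by (simp add: inner_add inner_diff inner_axis_axis inner_commute power2_eq_square algebra_simps)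
      then have "\<epsilon> * (norm (y + ?e))\<^sup>2 + \<epsilon> * (norm (y - ?e))\<^sup>2 = 2 * (\<epsilon> * (norm y)\<^sup>2) + 2 * \<epsilon> * h\<^sup>2"
        by (metis (no_types, opaque_lifting) distrib_left mult.left_commute mult.assoc)
      moreover have "f (y + ?e) - \<epsilon> * (norm (y + ?e))\<^sup>2 \<le> f y - \<epsilon> * (norm y)\<^sup>2"
        by (rule max) (use elim in \<open>simp add: dist_norm norm_axis_1\<close>)
      moreover have "f (y - ?e) - \<epsilon> * (norm (y - ?e))\<^sup>2 \<le> f y - \<epsilon> * (norm y)\<^sup>2"
        by (rule max) (use elim in \<open>simp add: dist_norm norm_axis_1\<close>)
      ultimately show ?thesis by linarith
    qed
    then have "(\<Sum>i\<in>UNIV. f (y + h *\<^sub>R axis i 1) + f (y - h *\<^sub>R axis i 1) - 2 * f y)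
        \<le> (\<Sum>i\<in>(UNIV :: 'n set). 2 * \<epsilon> * h\<^sup>2)"
      by (intro sum_mono) auto
    then show ?case using elim by (simp add: second_difference_sum_def pos_divide_le_eq mult_ac)
  qed
qed simp

text \<open>One function \<open>V\<close> serves as both Laplacian and time derivative, which is how
  the heat equation is expressed. The time derivative is taken from the left because the penalised
  maximum may sit at the final time.\<close>

lemma heat_maximum_principle:
  fixes W V :: "real^'n::finite \<Rightarrow> real \<Rightarrow> real"
  assumes cont: "continuous_on (UNIV \<times> {0..\<tau>}) (\<lambda>z. W (fst z) (snd z))"
    and bdd: "\<And>y t. t \<in> {0..\<tau>} \<Longrightarrow> W y t \<le> M"
    and init: "\<And>y. W y 0 \<le> 0"
    and lap: "\<And>y t. t \<in> {0..\<tau>} \<Longrightarrow>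
      (second_difference_sum (\<lambda>y. W y t) y \<longlongrightarrow> V y t) (at_right 0)"
    and time: "\<And>y t. t \<in> {0<..\<tau>} \<Longrightarrow>
      ((\<lambda>s. (W y t - W y s) / (t - s)) \<longlongrightarrow> V y t) (at_left t)"
    and t1: "t1 \<in> {0..\<tau>}"
  shows "W y1 t1 \<le> 0"
proof (rule ccontr)
  assume "\<not> W y1 t1 \<le> 0"
  then have W1: "W y1 t1 > 0" by simp
  \<comment> \<open>The Laplacian of |y|^2 is 2 n. One more than that makes \<epsilon> N \<le> V
    \<le> 2 n \<epsilon> contradictory at the maximum.\<close>
  define N where "N = 2 * real CARD('n) + 1"
  have N: "N > 0" by (simp add: N_def)
  define q where "q = (norm y1)\<^sup>2 + N * t1 + 1"
  have q: "q > 0" using N t1 by (auto simp: q_def intro!: add_nonneg_pos)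
  \<comment> \<open>With the extra 1 in \<open>q\<close>, the penalty at (y1, t1) is strictly below
    \<open>W y1 t1\<close>, so \<open>v\<close> is positive there.\<close>
  define \<epsilon> where "\<epsilon> = W y1 t1 / q"
  have \<epsilon>: "\<epsilon> > 0" using W1 q by (simp add: \<epsilon>_def)
  define v where "v = (\<lambda>z :: (real^'n) \<times> real. W (fst z) (snd z) - \<epsilon> * ((norm (fst z))\<^sup>2 + N * snd z))"
  have v1: "v (y1, t1) > 0"
  proof -
    have "\<epsilon> * ((norm y1)\<^sup>2 + N * t1) < \<epsilon> * q" using \<epsilon> by (simp add: q_def)
    also have "\<dots> = W y1 t1" using q by (simp add: \<epsilon>_def)
    finally show ?thesis by (simp add: v_def)
  qed
  \<comment> \<open>Where |y| \<ge> R, the penalty is at least \<open>M\<close>, so \<open>v\<close>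
    is not positive and its maximum avoids the lateral boundary. The other summands keep
    \<open>y1\<close> in the ball.\<close>
  define R where "R = sqrt (\<bar>M\<bar> / \<epsilon>) + norm y1 + 1"
  have R0: "R > 0" unfolding R_def using \<epsilon> by (intro add_nonneg_pos) auto
  have R: "\<epsilon> * R\<^sup>2 \<ge> M"
  proof -
    have "sqrt (\<bar>M\<bar> / \<epsilon>) \<le> R" by (simp add: R_def)
    then have "\<bar>M\<bar> / \<epsilon> \<le> R\<^sup>2" by (rule sqrt_le_D)
    then show ?thesis using \<epsilon> by (simp add: pos_divide_le_eq mult.commute)
  qed
  let ?K = "cball (0 :: real^'n) R \<times> {0..\<tau>}"
  have z1: "(y1, t1) \<in> ?K" using t1 \<epsilon> by (simp add: R_def)
  have contv: "continuous_on ?K v"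
    unfolding v_def
    by (intro continuous_intros continuous_on_subset[OF cont]) auto
  have "compact ?K" by (intro compact_Times) auto
  moreover have "?K \<noteq> {}" using z1 by blast
  ultimately have "\<exists>z0\<in>?K. \<forall>z\<in>?K. v z \<le> v z0"
    using contv by (rule continuous_attains_sup)
  then obtain z0 where z0: "z0 \<in> ?K" "\<And>z. z \<in> ?K \<Longrightarrow> v z \<le> v z0"
    by auto
  define y0 t0 where "y0 = fst z0" and "t0 = snd z0"
  have z0': "z0 = (y0, t0)" by (simp add: y0_def t0_def)
  have v0: "v (y0, t0) > 0" using z0(2)[OF z1] v1 z0' by simp
  have t0: "t0 \<in> {0..\<tau>}" using z0(1) z0' by simp
  have "t0 \<noteq> 0"
  proof
    assume "t0 = 0"
    moreover have "\<epsilon> * (norm y0)\<^sup>2 \<ge> 0" using \<epsilon> by simp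
    ultimately show False using v0 init[of y0] by (simp add: v_def)
  qed
  then have t0': "t0 \<in> {0<..\<tau>}" using t0 by auto
  have y0: "norm y0 < R"
  proof (rule ccontr)
    assume "\<not> norm y0 < R"
    then have "R\<^sup>2 \<le> (norm y0)\<^sup>2" using R0 by (intro power_mono) auto
    then have "M \<le> \<epsilon> * (norm y0)\<^sup>2" using R \<epsilon> by (meson mult_left_mono less_imp_le order_trans)
    moreover have "\<epsilon> * (N * t0) \<ge> 0" using \<epsilon> N t0 by simp
    ultimately show False using v0 bdd[OF t0, of y0] by (simp add: v_def distrib_left)
  qed
  have le: "V y0 t0 \<le> 2 * \<epsilon> * CARD('n)"
  proof (rule second_difference_sum_limit_at_max[OF lap[OF t0]])
    show "R - norm y0 > 0" using y0 by simp
    fix z assume "dist z y0 < R - norm y0"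
    then have "norm z \<le> R" using norm_triangle_sub[of z y0] by (simp add: dist_norm)
    then have "v (z, t0) \<le> v (y0, t0)" using z0(2)[of "(z, t0)"] t0 z0' by simp
    then show "W z t0 - \<epsilon> * (norm z)\<^sup>2 \<le> W y0 t0 - \<epsilon> * (norm y0)\<^sup>2"
      by (simp add: v_def distrib_left)
  qed
  have ge: "V y0 t0 \<ge> \<epsilon> * N"
  proof (rule tendsto_lowerbound[OF time[OF t0', of y0]])
    have "\<forall>\<^sub>F s in at_left t0. s \<in> {0<..<t0}"
      using t0' by (intro eventually_at_left_real) simp
    then show "\<forall>\<^sub>F s in at_left t0. \<epsilon> * N \<le> (W y0 t0 - W y0 s) / (t0 - s)"
    proof eventually_elim
      case (elim s)
      have "v (y0, s) \<le> v (y0, t0)" using z0(2)[of "(y0, s)"] elim t0 y0 z0' by simp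
      then have "\<epsilon> * N * (t0 - s) \<le> W y0 t0 - W y0 s" by (simp add: v_def algebra_simps)
      then show ?case using elim by (simp add: pos_le_divide_eq)
    qed
  qed simp
  have "\<epsilon> * N = 2 * \<epsilon> * CARD('n) + \<epsilon>" by (simp add: N_def algebra_simps)
  then show False using le ge \<epsilon> by linarith
qed

text \<open>Adding \<epsilon> |y|^2 makes H strictly subharmonic in the sense of second differences,
  so no interior maximum exists. Decay of H keeps the boundary values of a large ball below the
  value at \<open>y1\<close>.\<close>

lemma harmonic_maximum_principle:
  fixes H :: "real^'n::finite \<Rightarrow> real"
  assumes cont: "continuous_on UNIV H"
    and vanish: "(H \<longlongrightarrow> 0) at_infinity"
    and lap: "\<And>y. (second_difference_sum H y \<longlongrightarrow> 0) (at_right 0)"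
  shows "H y1 \<le> 0"
proof (rule ccontr)
  assume "\<not> H y1 \<le> 0"
  then have H1: "H y1 > 0" by simp
  then have "\<forall>\<^sub>F y in at_infinity. H y < H y1 / 2"
    using vanish by (intro order_tendstoD) auto
  then obtain B where B: "\<And>y. norm y \<ge> B \<Longrightarrow> H y < H y1 / 2"
    by (auto simp: eventually_at_infinity)
  define R where "R = \<bar>B\<bar> + norm y1 + 1"
  have R0: "R > 0" by (simp add: R_def add_nonneg_pos)
  \<comment> \<open>On the sphere of radius R the added term is exactly H(y1)/2, while H itself is
    below H(y1)/2 there.\<close>
  define \<epsilon> where "\<epsilon> = H y1 / (2 * R\<^sup>2)"
  have \<epsilon>: "\<epsilon> > 0" using H1 R0 by (simp add: \<epsilon>_def)
  define v where "v = (\<lambda>y. H y - (- \<epsilon>) * (norm y)\<^sup>2)"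
  have contv: "continuous_on (cball 0 R) v"
    unfolding v_def by (intro continuous_intros continuous_on_subset[OF cont]) auto
  have y1: "y1 \<in> cball 0 R" by (simp add: R_def)
  then have "\<exists>y0\<in>cball 0 R. \<forall>z\<in>cball 0 R. v z \<le> v y0"
    using contv by (intro continuous_attains_sup) (auto simp del: cball_eq_empty)
  then obtain y0 where y0: "y0 \<in> cball 0 R" "\<And>z. z \<in> cball 0 R \<Longrightarrow> v z \<le> v y0"
    by auto
  have "v y0 \<ge> H y1"
  proof -
    have "\<epsilon> * (norm y1)\<^sup>2 \<ge> 0" using \<epsilon> by simp
    then show ?thesis using y0(2)[OF y1] by (simp add: v_def)
  qed
  have "norm y0 < R"
  proof (rule ccontr)
    assume "\<not> norm y0 < R"
    then have eq: "norm y0 = R" using y0(1) by simp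
    then have "norm y0 \<ge> B" using norm_ge_zero[of y1] unfolding R_def by linarith
    then have "H y0 < H y1 / 2" by (rule B)
    moreover have "\<epsilon> * R\<^sup>2 = H y1 / 2" using R0 by (simp add: \<epsilon>_def)
    ultimately show False using \<open>v y0 \<ge> H y1\<close> eq by (simp add: v_def)
  qed
  have "0 \<le> 2 * (- \<epsilon>) * CARD('n)"
  proof (rule second_difference_sum_limit_at_max[OF lap])
    show "R - norm y0 > 0" using \<open>norm y0 < R\<close> by simp
    fix z assume "dist z y0 < R - norm y0"
    then have "norm z \<le> R" using norm_triangle_sub[of z y0] by (simp add: dist_norm)
    then show "H z - (- \<epsilon>) * (norm z)\<^sup>2 \<le> H y0 - (- \<epsilon>) * (norm y0)\<^sup>2"
      using y0(2)[of z] by (simp add: v_def)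
  qed
  moreover have "\<epsilon> * real CARD('n) > 0" using \<epsilon> by simp
  ultimately show False by simp
qed

section \<open>Square integrable functions\<close>

lemma L2_measurable: "f \<in> L2 \<Longrightarrow> f \<in> borel_measurable lebesgue"
  and L2_integrable: "f \<in> L2 \<Longrightarrow> integrable lebesgue (\<lambda>x. (norm (f x))\<^sup>2)"
  by (simp_all add: L2_def)

lemma L2_norm_nonneg: "L2_norm f \<ge> 0"
  by (simp add: L2_norm_def)

lemma L2_norm_power2: "(L2_norm f)\<^sup>2 = (LINT x|lebesgue. (norm (f x))\<^sup>2)"
  by (simp add: L2_norm_def)

lemma L2_add_scaleR:
  assumes "f \<in> L2" "g \<in> L2"
  shows "(\<lambda>x. f x + s *\<^sub>R g x) \<in> L2"
proof -
  have m: "(\<lambda>x. f x + s *\<^sub>R g x) \<in> borel_measurable lebesgue"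
    using assms by (intro borel_measurable_add borel_measurable_scaleR borel_measurable_const L2_measurable)
  have "integrable lebesgue (\<lambda>x. (norm (f x + s *\<^sub>R g x))\<^sup>2)"
  proof (rule Bochner_Integration.integrable_bound)
    show "integrable lebesgue (\<lambda>x. 2 * (norm (f x))\<^sup>2 + 2 * s\<^sup>2 * (norm (g x))\<^sup>2)"
      using assms[THEN L2_integrable] by simp
    show "(\<lambda>x. (norm (f x + s *\<^sub>R g x))\<^sup>2) \<in> borel_measurable lebesgue"
      using m by measurable
    have "(norm (f x + s *\<^sub>R g x))\<^sup>2 \<le> 2 * (norm (f x))\<^sup>2 + 2 * s\<^sup>2 * (norm (g x))\<^sup>2" for x
    proof -
      have "(norm (f x + s *\<^sub>R g x))\<^sup>2 \<le> (norm (f x) + norm (s *\<^sub>R g x))\<^sup>2"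
        by (intro power_mono norm_triangle_ineq) simp
      also have "\<dots> \<le> 2 * (norm (f x))\<^sup>2 + 2 * (norm (s *\<^sub>R g x))\<^sup>2"
        using sum_squares_bound[of "norm (f x)" "norm (s *\<^sub>R g x)"] by (simp add: power2_sum)
      finally show ?thesis by (simp add: power_mult_distrib)
    qed
    then show "AE x in lebesgue. norm ((norm (f x + s *\<^sub>R g x))\<^sup>2)
        \<le> norm (2 * (norm (f x))\<^sup>2 + 2 * s\<^sup>2 * (norm (g x))\<^sup>2)" by simp
  qed
  then show ?thesis using m by (simp add: L2_def)
qed

lemma L2_diff: "f \<in> L2 \<Longrightarrow> g \<in> L2 \<Longrightarrow> (\<lambda>x. f x - g x) \<in> L2"
  using L2_add_scaleR[of f g "-1"] by simp

lemma L2_inner_integrable: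
  assumes "f \<in> L2" "g \<in> L2"
  shows "integrable lebesgue (\<lambda>x. f x \<bullet> g x)"
proof (rule Bochner_Integration.integrable_bound)
  show "integrable lebesgue (\<lambda>x. (norm (f x))\<^sup>2 + (norm (g x))\<^sup>2)"
    using assms[THEN L2_integrable] by simp
  show "(\<lambda>x. f x \<bullet> g x) \<in> borel_measurable lebesgue"
    using assms[THEN L2_measurable] by measurable
  have "\<bar>f x \<bullet> g x\<bar> \<le> (norm (f x))\<^sup>2 + (norm (g x))\<^sup>2" for x
    using Cauchy_Schwarz_ineq2[of "f x" "g x"] sum_squares_bound[of "norm (f x)" "norm (g x)"]
      mult_nonneg_nonneg[OF norm_ge_zero norm_ge_zero, of "f x" "g x"] by linarith
  then show "AE x in lebesgue. norm (f x \<bullet> g x) \<le> norm ((norm (f x))\<^sup>2 + (norm (g x))\<^sup>2)"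
    by simp
qed

lemma quadratic_nonneg_imp_discriminant:
  fixes A B C :: real
  assumes "\<And>s. A + 2 * s * C + s\<^sup>2 * B \<ge> 0" "B \<ge> 0"
  shows "C\<^sup>2 \<le> A * B"
proof (cases "B = 0")
  case True
  have "C = 0"
  proof (rule ccontr)
    assume "C \<noteq> 0"
    \<comment> \<open>For B = 0 the expression is affine in s, and it equals -1 at this s.\<close>
    then show False using assms(1)[of "- (A + 1) / (2 * C)"] True by (simp add: field_simps)
  qed
  then show ?thesis using True by simp
next
  case False
  then have "A - C\<^sup>2 / B \<ge> 0"
    using assms(1)[of "- C / B"] by (simp add: power2_eq_square field_simps)
  then show ?thesis using False assms(2) by (simp add: field_simps)
qed

lemma L2_Cauchy_Schwarz:
  assumes f: "f \<in> L2" and g: "g \<in> L2"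
  shows "\<bar>LINT x|lebesgue. f x \<bullet> g x\<bar> \<le> L2_norm f * L2_norm g"
proof -
  let ?C = "LINT x|lebesgue. f x \<bullet> g x"
  have "(L2_norm f)\<^sup>2 + 2 * s * ?C + s\<^sup>2 * (L2_norm g)\<^sup>2 \<ge> 0" for s
  proof -
    have "(norm (f x + s *\<^sub>R g x))\<^sup>2 = (norm (f x))\<^sup>2 + 2 * s * (f x \<bullet> g x) + s\<^sup>2 * (norm (g x))\<^sup>2" for x
      unfolding power2_norm_eq_inner
      by (simp add: inner_add inner_commute power2_eq_square algebra_simps)
    then have "(LINT x|lebesgue. (norm (f x + s *\<^sub>R g x))\<^sup>2)
        = (L2_norm f)\<^sup>2 + 2 * s * ?C + s\<^sup>2 * (L2_norm g)\<^sup>2"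
      using L2_integrable[OF f] L2_integrable[OF g] L2_inner_integrable[OF f g]
      by (simp add: L2_norm_power2)
    moreover have "(LINT x|lebesgue. (norm (f x + s *\<^sub>R g x))\<^sup>2) \<ge> 0" by simp
    ultimately show ?thesis by simp
  qed
  then have "?C\<^sup>2 \<le> (L2_norm f)\<^sup>2 * (L2_norm g)\<^sup>2"
    by (rule quadratic_nonneg_imp_discriminant) simp
  then have "\<bar>?C\<bar>\<^sup>2 \<le> (L2_norm f * L2_norm g)\<^sup>2" by (simp add: power_mult_distrib)
  then show ?thesis
    by (rule power2_le_imp_le) (simp add: L2_norm_nonneg)
qed

lemma measure_lebesgue_cball:
  "measure lebesgue (cball (c :: 'a::euclidean_space) r) = measure lebesgue (cball (0 :: 'a) r)"
proof -
  have "cball c r = (+) c ` cball 0 r" using cball_translation[of c 0 r] by simp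
  then show ?thesis by (simp only: measure_translation)
qed

lemma integrable_indicator_cball: "integrable lebesgue (indicator (cball c r) :: 'a::euclidean_space \<Rightarrow> real)"
  using lmeasurable_cball lmeasurable_iff_integrable by blast

text \<open>By translation invariance the bound does not involve the centre \<open>c\<close>; this
  makes the estimates for correlations uniform in the shift.\<close>

lemma bounded_support_L2:
  fixes g :: "'a::euclidean_space \<Rightarrow> 'b::euclidean_space"
  assumes m: "g \<in> borel_measurable lebesgue" and b: "\<And>x. norm (g x) \<le> M * indicator (cball c r) x"
  shows "g \<in> L2" "(L2_norm g)\<^sup>2 \<le> M\<^sup>2 * measure lebesgue (cball (0::'a) r)"
proof -
  have le: "(norm (g x))\<^sup>2 \<le> M\<^sup>2 * indicator (cball c r) x" for x
    using power_mono[OF b[of x] norm_ge_zero, of 2] by (auto simp: indicator_def split: if_splits)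
  have i: "integrable lebesgue (\<lambda>x. M\<^sup>2 * indicator (cball c r) x)"
    by (simp add: integrable_indicator_cball)
  have "integrable lebesgue (\<lambda>x. (norm (g x))\<^sup>2)"
  proof (rule Bochner_Integration.integrable_bound[OF i])
    show "(\<lambda>x. (norm (g x))\<^sup>2) \<in> borel_measurable lebesgue" using m by measurable
    show "AE x in lebesgue. norm ((norm (g x))\<^sup>2) \<le> norm (M\<^sup>2 * indicator (cball c r) x)"
      using le by (intro AE_I2) (auto intro: order_trans)
  qed
  then show "g \<in> L2" using m by (simp add: L2_def)
  then have "(LINT x|lebesgue. (norm (g x))\<^sup>2) \<le> (LINT x|lebesgue. M\<^sup>2 * indicator (cball c r) x)"
    using le i L2_integrable by (intro integral_mono) auto
  then show "(L2_norm g)\<^sup>2 \<le> M\<^sup>2 * measure lebesgue (cball (0::'a) r)"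
    by (simp add: L2_norm_power2 measure_lebesgue_cball[of c])
qed

text \<open>Dominated convergence along sequences. Since |ab| \<le> a^2 + b^2, the square of |f|
  plus a multiple of the indicator of one fixed ball dominates all integrands.\<close>

lemma integral_inner_tendsto:
  fixes f :: "'a::euclidean_space \<Rightarrow> 'b::euclidean_space" and g :: "'c::first_countable_topology \<Rightarrow> 'a \<Rightarrow> 'b"
  assumes f: "f \<in> L2"
    and ev: "\<forall>\<^sub>F h in at a within S. \<forall>x. norm (g h x) \<le> M * indicator (cball c r) x"
    and meas: "\<And>h. g h \<in> borel_measurable lebesgue" "g0 \<in> borel_measurable lebesgue"
    and lim: "\<And>x. ((\<lambda>h. g h x) \<longlongrightarrow> g0 x) (at a within S)"
  shows "((\<lambda>h. LINT x|lebesgue. f x \<bullet> g h x) \<longlongrightarrow> (LINT x|lebesgue. f x \<bullet> g0 x)) (at a within S)"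
  unfolding tendsto_at_iff_sequentially
proof (intro allI impI)
  fix X assume X: "\<forall>i. X i \<in> S - {a}" "X \<longlonglongrightarrow> a"
  then have fl: "filterlim X (at a within S) sequentially"
    by (auto simp: filterlim_at)
  have "\<forall>\<^sub>F n in sequentially. \<forall>x. norm (g (X n) x) \<le> M * indicator (cball c r) x"
    using fl ev by (auto simp: filterlim_iff)
  then obtain N where N: "\<And>n x. n \<ge> N \<Longrightarrow> norm (g (X n) x) \<le> M * indicator (cball c r) x"
    by (auto simp: eventually_sequentially)
  have "(\<lambda>n. LINT x|lebesgue. f x \<bullet> g (X (n + N)) x) \<longlonglongrightarrow> (LINT x|lebesgue. f x \<bullet> g0 x)"
  proof (rule integral_dominated_convergence)
    show "(\<lambda>x. f x \<bullet> g0 x) \<in> borel_measurable lebesgue"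
      using L2_measurable[OF f] meas by measurable
    show "(\<lambda>x. f x \<bullet> g (X (n + N)) x) \<in> borel_measurable lebesgue" for n
      using L2_measurable[OF f] meas by measurable
    show "integrable lebesgue (\<lambda>x. (norm (f x))\<^sup>2 + M\<^sup>2 * indicator (cball c r) x)"
      using L2_integrable[OF f] by (simp add: integrable_indicator_cball)
    show "AE x in lebesgue. (\<lambda>n. f x \<bullet> g (X (n + N)) x) \<longlonglongrightarrow> f x \<bullet> g0 x"
    proof (intro AE_I2 tendsto_inner tendsto_const)
      fix x
      show "(\<lambda>n. g (X (n + N)) x) \<longlonglongrightarrow> g0 x"
        by (rule LIMSEQ_ignore_initial_segment, rule filterlim_compose[OF lim fl])
    qed
    show "AE x in lebesgue. norm (f x \<bullet> g (X (n + N)) x) \<le> (norm (f x))\<^sup>2 + M\<^sup>2 * indicator (cball c r) x" for n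
    proof (rule AE_I2)
      fix x
      let ?a = "norm (f x)" and ?b = "norm (g (X (n + N)) x)"
      have "?b\<^sup>2 \<le> M\<^sup>2 * indicator (cball c r) x"
        using power_mono[OF N[of "n + N" x] norm_ge_zero, of 2] by (auto simp: indicator_def split: if_splits)
      moreover have "\<bar>f x \<bullet> g (X (n + N)) x\<bar> \<le> ?a * ?b" by (rule Cauchy_Schwarz_ineq2)
      moreover have "?a * ?b \<ge> 0" by simp
      ultimately show "norm (f x \<bullet> g (X (n + N)) x) \<le> ?a\<^sup>2 + M\<^sup>2 * indicator (cball c r) x"
        using sum_squares_bound[of ?a ?b] unfolding real_norm_def by linarith
    qed
  qed
  then show "((\<lambda>h. LINT x|lebesgue. f x \<bullet> g h x) \<circ> X) \<longlonglongrightarrow> (LINT x|lebesgue. f x \<bullet> g0 x)"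
    unfolding comp_def by (rule LIMSEQ_offset)
qed

section \<open>Correlation with a compactly supported kernel\<close>

definition bounded_kernel :: "real \<Rightarrow> real \<Rightarrow> ('a::euclidean_space \<Rightarrow> 'b::euclidean_space) \<Rightarrow> bool" where
  "bounded_kernel M r g \<longleftrightarrow> continuous_on UNIV g \<and> (\<forall>x. norm (g x) \<le> M * indicator (cball 0 r) x)"

text \<open>Unlike in a convolution, the kernel is not reflected: for fixed \<open>y\<close> the
  second factor is a translate of \<open>g\<close>, hence again a test function. Second differences
  in \<open>y\<close> and in the argument of \<open>g\<close> agree because they are even in the
  step.\<close>

definition correlation ::
    "('a::euclidean_space \<Rightarrow> 'b::euclidean_space) \<Rightarrow> ('a \<Rightarrow> 'b) \<Rightarrow> 'a \<Rightarrow> real" where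
  "correlation f g y = (LINT x|lebesgue. f x \<bullet> g (x - y))"

lemma bounded_kernel_shift_measurable:
  assumes "bounded_kernel M r g"
  shows "(\<lambda>x. g (x - y)) \<in> borel_measurable lebesgue"
proof -
  have "continuous_on UNIV (\<lambda>x. g (x - y))"
    using assms unfolding bounded_kernel_def
    by (auto intro!: continuous_intros continuous_on_compose2[of UNIV g])
  then show ?thesis by (intro measurable_completion) (simp add: borel_measurable_continuous_onI)
qed

lemma bounded_kernel_shift_bound:
  assumes "bounded_kernel M r g"
  shows "norm (g (x - y)) \<le> M * indicator (cball y r) x"
proof -
  have "norm (g (x - y)) \<le> M * indicator (cball 0 r) (x - y)"
    using assms by (simp add: bounded_kernel_def)
  also have "indicator (cball 0 r) (x - y) = (indicator (cball y r) x :: real)"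
    by (simp add: indicator_def dist_norm norm_minus_commute)
  finally show ?thesis .
qed

lemma bounded_kernel_shift_L2:
  fixes g :: "'a::euclidean_space \<Rightarrow> 'b::euclidean_space"
  assumes "bounded_kernel M r g"
  shows "(\<lambda>x. g (x - y)) \<in> L2"
    and "(L2_norm (\<lambda>x. g (x - y)))\<^sup>2 \<le> M\<^sup>2 * measure lebesgue (cball (0::'a) r)"
  using bounded_support_L2[OF bounded_kernel_shift_measurable[OF assms], of y M y r]
    bounded_kernel_shift_bound[OF assms] by auto

text \<open>A common bound for the L2 norms of all translates of a kernel. The type argument fixes
  the space, on which the volume of the ball depends.\<close>

definition kernel_norm :: "real \<Rightarrow> real \<Rightarrow> 'a::euclidean_space itself \<Rightarrow> real" where
  "kernel_norm M r _ = sqrt (M\<^sup>2 * measure lebesgue (cball (0::'a) r))"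

lemma bounded_kernel_shift_norm:
  fixes g :: "'a::euclidean_space \<Rightarrow> 'b::euclidean_space"
  assumes "bounded_kernel M r g"
  shows "L2_norm (\<lambda>x. g (x - y)) \<le> kernel_norm M r TYPE('a)"
  unfolding kernel_norm_def
  using bounded_kernel_shift_L2(2)[OF assms, of y] by (rule real_le_rsqrt)

lemma correlation_integrable:
  assumes "f \<in> L2" "bounded_kernel M r g"
  shows "integrable lebesgue (\<lambda>x. f x \<bullet> g (x - y))"
  by (rule L2_inner_integrable[OF assms(1) bounded_kernel_shift_L2(1)[OF assms(2)]])

lemma correlation_bound:
  fixes f :: "'a::euclidean_space \<Rightarrow> 'b::euclidean_space"
  assumes "f \<in> L2" "bounded_kernel M r g"
  shows "\<bar>correlation f g y\<bar> \<le> L2_norm f * kernel_norm M r TYPE('a)"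
proof -
  have "\<bar>correlation f g y\<bar> \<le> L2_norm f * L2_norm (\<lambda>x. g (x - y))"
    unfolding correlation_def
    by (rule L2_Cauchy_Schwarz[OF assms(1) bounded_kernel_shift_L2(1)[OF assms(2)]])
  also have "\<dots> \<le> L2_norm f * kernel_norm M r TYPE('a)"
    by (intro mult_left_mono bounded_kernel_shift_norm assms L2_norm_nonneg)
  finally show ?thesis .
qed

lemma correlation_diff:
  assumes "f \<in> L2" "f' \<in> L2" "bounded_kernel M r g"
  shows "correlation f g y - correlation f' g y = correlation (\<lambda>x. f x - f' x) g y"
  unfolding correlation_def
  using correlation_integrable[OF assms(1,3)] correlation_integrable[OF assms(2,3)]
  by (simp add: inner_diff_left)

lemma correlation_continuous:
  assumes f: "f \<in> L2" and g: "bounded_kernel M r g"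
  shows "continuous_on UNIV (correlation f g)"
proof -
  have "isCont (correlation f g) y" for y
    unfolding isCont_def correlation_def
  proof (rule integral_inner_tendsto[OF f])
    have "\<forall>\<^sub>F y' in at y. dist y' y < 1" by (rule eventually_at_ball'[of 1 y UNIV, simplified, THEN eventually_mono]) (auto simp: dist_commute)
    \<comment> \<open>For shifts within distance 1 of \<open>y\<close>, all supports lie in one ball
      of radius r + 1, which yields a dominating function that does not move.\<close>
    then show "\<forall>\<^sub>F y' in at y. \<forall>x. norm (g (x - y')) \<le> \<bar>M\<bar> * indicator (cball y (r + 1)) x"
    proof eventually_elim
      case (elim y')
      show ?case
      proof
        fix x
        have "norm (g (x - y')) \<le> M * indicator (cball y' r) x"
          by (rule bounded_kernel_shift_bound[OF g])
        also have "\<dots> \<le> \<bar>M\<bar> * indicator (cball y (r + 1)) x"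
        proof -
          have "cball y' r \<subseteq> cball y (r + 1)"
            using elim by (simp add: subset_iff) (smt (verit) dist_commute dist_triangle)
          then show ?thesis by (auto simp: indicator_def)
        qed
        finally show "norm (g (x - y')) \<le> \<bar>M\<bar> * indicator (cball y (r + 1)) x" .
      qed
    qed
    show "((\<lambda>y'. g (x - y')) \<longlongrightarrow> g (x - y)) (at y)" for x
    proof -
      have "isCont g (x - y)" using g by (simp add: bounded_kernel_def continuous_on_eq_continuous_at)
      then have "isCont (\<lambda>y'. g (x - y')) y" by (intro continuous_intros isCont_o2[of y _ g]) auto
      then show ?thesis by (simp add: isCont_def)
    qed
  qed (rule bounded_kernel_shift_measurable[OF g])+
  then show ?thesis by (simp add: continuous_at_imp_continuous_on)
qed

text \<open>A kernel supported in radius \<open>r\<close> around \<open>y\<close> meets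
  \<open>f\<close> only where |x| \<ge> |y| - r, and the L2 norm of \<open>f\<close> outside a
  growing ball tends to 0. This is what excludes nonzero constants as harmonic correlations.\<close>

lemma correlation_vanishes_at_infinity:
  fixes f :: "'a::euclidean_space \<Rightarrow> 'b::euclidean_space"
  assumes f: "f \<in> L2" and g: "bounded_kernel M r g"
  shows "(correlation f g \<longlongrightarrow> 0) at_infinity"
proof -
  define tail where "tail = (\<lambda>\<rho> x. indicator {x. norm x \<ge> \<rho>} x *\<^sub>R f x)"
  have m: "tail \<rho> \<in> borel_measurable lebesgue" for \<rho>
  proof -
    have "closed {x::'a. norm x \<ge> \<rho>}" by (intro closed_Collect_le continuous_intros)
    then have "{x::'a. norm x \<ge> \<rho>} \<in> sets lebesgue" by (simp add: borel_closed)
    then show ?thesis unfolding tail_def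
      using L2_measurable[OF f] by (intro borel_measurable_scaleR borel_measurable_indicator)
  qed
  have tail_le: "(norm (tail \<rho> x))\<^sup>2 \<le> (norm (f x))\<^sup>2" for \<rho> x
    by (auto simp: tail_def indicator_def)
  have tail: "tail \<rho> \<in> L2" for \<rho>
  proof -
    have "integrable lebesgue (\<lambda>x. (norm (tail \<rho> x))\<^sup>2)"
    proof (rule Bochner_Integration.integrable_bound[OF L2_integrable[OF f]])
      show "(\<lambda>x. (norm (tail \<rho> x))\<^sup>2) \<in> borel_measurable lebesgue" using m by measurable
      show "AE x in lebesgue. norm ((norm (tail \<rho> x))\<^sup>2) \<le> norm ((norm (f x))\<^sup>2)"
        using tail_le by simp
    qed
    then show ?thesis using m by (simp add: L2_def)
  qed
  have "((\<lambda>\<rho>. LINT x|lebesgue. (norm (tail \<rho> x))\<^sup>2) \<longlongrightarrow> (LINT x|(lebesgue :: 'a measure). 0)) at_top"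
  proof (rule integral_dominated_convergence_at_top)
    show "(\<lambda>x. (norm (tail \<rho> x))\<^sup>2) \<in> borel_measurable lebesgue" for \<rho> using m by measurable
    show "integrable lebesgue (\<lambda>x. (norm (f x))\<^sup>2)" by (rule L2_integrable[OF f])
    show "AE x in lebesgue. ((\<lambda>\<rho>. (norm (tail \<rho> x))\<^sup>2) \<longlongrightarrow> 0) at_top"
    proof (rule AE_I2)
      fix x
      have "\<forall>\<^sub>F \<rho> in at_top. (norm (tail \<rho> x))\<^sup>2 = 0"
        using eventually_gt_at_top[of "norm x"] by eventually_elim (simp add: tail_def)
      then show "((\<lambda>\<rho>. (norm (tail \<rho> x))\<^sup>2) \<longlongrightarrow> 0) at_top" by (rule tendsto_eventually)
    qed
    show "\<forall>\<^sub>F \<rho> in at_top. AE x in lebesgue. norm ((norm (tail \<rho> x))\<^sup>2) \<le> (norm (f x))\<^sup>2"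
      using tail_le by (intro always_eventually) simp
  qed simp
  then have "((\<lambda>\<rho>. sqrt (LINT x|lebesgue. (norm (tail \<rho> x))\<^sup>2) * kernel_norm M r TYPE('a))
      \<longlongrightarrow> sqrt 0 * kernel_norm M r TYPE('a)) at_top"
    by (intro tendsto_intros) simp
  then have l1: "((\<lambda>\<rho>. L2_norm (tail \<rho>) * kernel_norm M r TYPE('a)) \<longlongrightarrow> 0) at_top"
    by (simp add: L2_norm_def)
  have l2: "filterlim (\<lambda>y::'a. - r + norm y) at_top at_infinity"
    by (rule filterlim_tendsto_add_at_top[OF tendsto_const filterlim_norm_at_top])
  have "((\<lambda>y::'a. L2_norm (tail (- r + norm y)) * kernel_norm M r TYPE('a)) \<longlongrightarrow> 0) at_infinity"
    by (rule filterlim_compose[OF l1 l2])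
  then show ?thesis
  proof (rule Lim_null_comparison[rotated])
    have "\<bar>correlation f g y\<bar> \<le> L2_norm (tail (- r + norm y)) * kernel_norm M r TYPE('a)" for y
    proof -
      have "f x \<bullet> g (x - y) = tail (- r + norm y) x \<bullet> g (x - y)" for x
      proof (cases "norm x \<ge> - r + norm y")
        case False
        then have "x \<notin> cball y r"
          using norm_triangle_ineq2[of y x] by (auto simp: dist_norm)
        then have "g (x - y) = 0" using bounded_kernel_shift_bound[OF g, of x y] by simp
        then show ?thesis by simp
      qed (simp add: tail_def)
      then have "correlation f g y = correlation (tail (- r + norm y)) g y"
        unfolding correlation_def by presburger
      then show ?thesis using correlation_bound[OF tail g] by simp
    qed
    then show "\<forall>\<^sub>F y in at_infinity. norm (correlation f g y)
        \<le> L2_norm (tail (- r + norm y)) * kernel_norm M r TYPE('a)"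
      by simp
  qed
qed

text \<open>The defect D(s) = a(s) + a(-s) - 2 a(0) - s^2 c vanishes at 0 together with its
  derivative, so the mean value inequality applied twice suffices. The vector \<open>c\<close> is
  free: the second derivative at 0 gives the limit, and c = 0 gives a uniform bound.\<close>

lemma second_difference_bound:
  fixes a a' a'' :: "real \<Rightarrow> 'b::real_inner"
  assumes d1: "\<And>s. (a has_vector_derivative a' s) (at s)"
    and d2: "\<And>s. (a' has_vector_derivative a'' s) (at s)"
    and b: "\<And>s. \<bar>s\<bar> \<le> h \<Longrightarrow> norm (a'' s - c) \<le> \<epsilon>" and h: "h > 0"
  shows "norm (a h + a (- h) - 2 *\<^sub>R a 0 - h\<^sup>2 *\<^sub>R c) \<le> 2 * \<epsilon> * h\<^sup>2"
proof -
  have neg: "((\<lambda>s. k (- s)) has_vector_derivative - k' (- s)) (at s)"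
    if "\<And>s. (k has_vector_derivative k' s) (at s)" for k k' :: "real \<Rightarrow> 'b" and s
  proof -
    have "(uminus has_vector_derivative -1) (at s)"
      by (auto intro!: derivative_eq_intros)
    from vector_diff_chain_at[OF this that[of "- s"]] show ?thesis by (simp add: comp_def)
  qed
  define D D' D'' where "D = (\<lambda>s. a s + a (- s) - 2 *\<^sub>R a 0 - s\<^sup>2 *\<^sub>R c)"
    and "D' = (\<lambda>s. a' s - a' (- s) - (2 * s) *\<^sub>R c)"
    and "D'' = (\<lambda>s. a'' s + a'' (- s) - 2 *\<^sub>R c)"
  have dD: "(D has_vector_derivative D' s) (at s)" for s
    unfolding D_def D'_def
    by (rule derivative_eq_intros has_vector_derivative_real_field d1 neg[OF d1] refl | simp)+
  have dD': "(D' has_vector_derivative D'' s) (at s)" for s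
    unfolding D'_def D''_def
    by (rule derivative_eq_intros has_vector_derivative_real_field d2 neg[OF d2] refl | simp)+
  have mv: "norm (k s - k 0) \<le> B * s"
    if k: "\<And>s. (k has_vector_derivative k' s) (at s)" and B: "\<And>\<sigma>. 0 < \<sigma> \<Longrightarrow> \<sigma> < s \<Longrightarrow> norm (k' \<sigma>) \<le> B"
      and s: "s > 0" for k k' :: "real \<Rightarrow> 'b" and B s
  proof -
    have "continuous_on {0..s} k"
      using k by (meson continuous_at_imp_continuous_on has_vector_derivative_continuous)
    then obtain \<sigma> where \<sigma>: "\<sigma> \<in> {0<..<s}" "norm (k s - k 0) \<le> norm ((s - 0) *\<^sub>R k' \<sigma>)"
      using mvt_general[OF s, of k "\<lambda>x t. t *\<^sub>R k' x"] k unfolding has_vector_derivative_def by blast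
    have "norm (k s - k 0) \<le> s * norm (k' \<sigma>)" using \<sigma>(2) s by simp
    also have "\<dots> \<le> s * B" using B \<sigma>(1) s by (intro mult_left_mono) auto
    finally show ?thesis by (simp add: mult.commute)
  qed
  have bD'': "norm (D'' s) \<le> 2 * \<epsilon>" if "0 < s" "s < h" for s
  proof -
    have "D'' s = (a'' s - c) + (a'' (- s) - c)" by (simp add: D''_def scaleR_2)
    then show ?thesis using b[of s] b[of "- s"] that norm_triangle_ineq[of "a'' s - c" "a'' (- s) - c"]
      by simp
  qed
  have bD': "norm (D' s) \<le> 2 * \<epsilon> * h" if "0 < s" "s < h" for s
  proof -
    have "norm (D' s - D' 0) \<le> 2 * \<epsilon> * s"
      by (rule mv[OF dD']) (use bD'' that in auto)
    also have "\<dots> \<le> 2 * \<epsilon> * h"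
      using that order_trans[OF norm_ge_zero b[of 0]] by (intro mult_left_mono) auto
    finally show ?thesis by (simp add: D'_def)
  qed
  have "norm (D h - D 0) \<le> 2 * \<epsilon> * h * h"
    by (rule mv[OF dD]) (use bD' h in auto)
  then show ?thesis by (simp add: D_def scaleR_2 power2_eq_square mult.assoc)
qed

lemma derivative_family_bounded_kernel:
  fixes A :: "('n::finite \<Rightarrow> nat) \<Rightarrow> real^'n \<Rightarrow> 'b::euclidean_space"
  assumes A: "derivative_family A" "supported_on (cball 0 r) A"
  obtains M where "M \<ge> 0" "bounded_kernel M r (A k)"
proof -
  have "compact (A k ` cball 0 r)"
    using derivative_family_continuous[OF A(1)] by (intro compact_continuous_image) auto
  then obtain M where M: "M > 0" "\<And>x. x \<in> cball 0 r \<Longrightarrow> norm (A k x) \<le> M"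
    by (auto simp: bounded_pos dest!: compact_imp_bounded)
  have "norm (A k x) \<le> M * indicator (cball 0 r) x" for x
    using M A(2) by (cases "x \<in> cball 0 r") (auto simp: supported_on_def)
  then have "bounded_kernel M r (A k)"
    using derivative_family_continuous[OF A(1)] by (simp add: bounded_kernel_def)
  then show ?thesis using that M(1) by (meson less_imp_le)
qed

lemma derivative_family_line:
  fixes A :: "('n::finite \<Rightarrow> nat) \<Rightarrow> real^'n \<Rightarrow> 'b::euclidean_space"
  assumes "derivative_family A"
  shows "((\<lambda>s. A k (z + s *\<^sub>R axis i 1)) has_vector_derivative A (inc i k) (z + s *\<^sub>R axis i 1)) (at s)"
proof -
  have "((\<lambda>s. z + s *\<^sub>R axis i 1) has_derivative (\<lambda>t. t *\<^sub>R axis i 1)) (at s)"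
    by (auto intro!: derivative_eq_intros)
  moreover have "(A k has_derivative
      (\<lambda>v. \<Sum>j\<in>UNIV. (v $ j) *\<^sub>R A (inc j k) (z + s *\<^sub>R axis i 1))) (at (z + s *\<^sub>R axis i 1))"
    using assms by (simp add: derivative_family_def)
  ultimately have "((\<lambda>s. A k (z + s *\<^sub>R axis i 1)) has_derivative
      (\<lambda>t. \<Sum>j\<in>UNIV. ((t *\<^sub>R axis i 1 :: real^'n) $ j) *\<^sub>R A (inc j k) (z + s *\<^sub>R axis i 1))) (at s)"
    by (rule has_derivative_compose)
  moreover have "(\<lambda>t. \<Sum>j\<in>UNIV. ((t *\<^sub>R axis i 1 :: real^'n) $ j) *\<^sub>R A (inc j k) (z + s *\<^sub>R axis i 1))
      = (\<lambda>t. t *\<^sub>R A (inc i k) (z + s *\<^sub>R axis i 1))"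
  proof
    fix t
    have "(\<Sum>j\<in>UNIV. ((t *\<^sub>R axis i 1 :: real^'n) $ j) *\<^sub>R A (inc j k) (z + s *\<^sub>R axis i 1))
        = (\<Sum>j\<in>UNIV. if j = i then t *\<^sub>R A (inc i k) (z + s *\<^sub>R axis i 1) else 0)"
      by (rule sum.cong) (auto simp: axis_def)
    then show "(\<Sum>j\<in>UNIV. ((t *\<^sub>R axis i 1 :: real^'n) $ j) *\<^sub>R A (inc j k) (z + s *\<^sub>R axis i 1))
        = t *\<^sub>R A (inc i k) (z + s *\<^sub>R axis i 1)"
      by simp
  qed
  ultimately show ?thesis by (simp add: has_vector_derivative_def)
qed

lemma derivative_family_second_difference:
  fixes A :: "('n::finite \<Rightarrow> nat) \<Rightarrow> real^'n \<Rightarrow> 'b::euclidean_space"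
  assumes A: "derivative_family A"
    and b: "\<And>s. \<bar>s\<bar> \<le> h \<Longrightarrow> norm (A (inc i (inc i k)) (z + s *\<^sub>R axis i 1) - c) \<le> \<epsilon>" and h: "h > 0"
  shows "norm (A k (z + h *\<^sub>R axis i 1) + A k (z - h *\<^sub>R axis i 1) - 2 *\<^sub>R A k z - h\<^sup>2 *\<^sub>R c) \<le> 2 * \<epsilon> * h\<^sup>2"
  using second_difference_bound[OF derivative_family_line[OF A] derivative_family_line[OF A] b h]
  by simp

lemma derivative_family_second_difference_limit:
  fixes A :: "('n::finite \<Rightarrow> nat) \<Rightarrow> real^'n \<Rightarrow> 'b::euclidean_space"
  assumes A: "derivative_family A"
  shows "((\<lambda>h. (A k (z + h *\<^sub>R axis i 1) + A k (z - h *\<^sub>R axis i 1) - 2 *\<^sub>R A k z) /\<^sub>R h\<^sup>2)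
    \<longlongrightarrow> A (inc i (inc i k)) z) (at_right 0)"
proof (rule tendstoI)
  fix \<epsilon> :: real assume "\<epsilon> > 0"
  let ?c = "A (inc i (inc i k)) z"
  have "isCont (A (inc i (inc i k))) z"
    using derivative_family_continuous[OF A] by (metis UNIV_I continuous_on_eq_continuous_at open_UNIV)
  then obtain d where d: "d > 0" "\<And>z'. dist z' z < d \<Longrightarrow> dist (A (inc i (inc i k)) z') ?c < \<epsilon> / 4"
    using \<open>\<epsilon> > 0\<close> unfolding continuous_at_eps_delta
    by (metis zero_less_divide_iff zero_less_numeral)
  have "\<forall>\<^sub>F h in at_right 0. h \<in> {0<..<d}" using d(1) by (rule eventually_at_right_real)
  then show "\<forall>\<^sub>F h in at_right 0. dist ((A k (z + h *\<^sub>R axis i 1) + A k (z - h *\<^sub>R axis i 1) - 2 *\<^sub>R A k z) /\<^sub>R h\<^sup>2) ?c < \<epsilon>"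
  proof eventually_elim
    case (elim h)
    let ?D = "A k (z + h *\<^sub>R axis i 1) + A k (z - h *\<^sub>R axis i 1) - 2 *\<^sub>R A k z"
    have le: "norm (?D - h\<^sup>2 *\<^sub>R ?c) \<le> 2 * (\<epsilon> / 4) * h\<^sup>2"
    proof (rule derivative_family_second_difference[OF A])
      fix s assume "\<bar>s\<bar> \<le> h"
      then have "dist (z + s *\<^sub>R axis i 1) z < d" using elim by (simp add: dist_norm norm_axis_1)
      then show "norm (A (inc i (inc i k)) (z + s *\<^sub>R axis i 1) - ?c) \<le> \<epsilon> / 4"
        using d(2) by (metis dist_norm less_imp_le)
    qed (use elim in simp)
    have "?D /\<^sub>R h\<^sup>2 - ?c = (?D - h\<^sup>2 *\<^sub>R ?c) /\<^sub>R h\<^sup>2" using elim by (simp add: scaleR_diff_right)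
    then have "dist (?D /\<^sub>R h\<^sup>2) ?c = norm (?D - h\<^sup>2 *\<^sub>R ?c) / h\<^sup>2"
      by (simp add: dist_norm divide_inverse mult.commute)
    also have "\<dots> \<le> \<epsilon> / 2" using le elim by (simp add: pos_divide_le_eq)
    also have "\<dots> < \<epsilon>" using \<open>\<epsilon> > 0\<close> by simp
    finally show ?case .
  qed
qed

text \<open>The second difference is transferred to the kernel by linearity. There the quotients
  converge pointwise and are dominated, so \<open>f\<close> needs no regularity.\<close>

lemma correlation_second_difference:
  fixes A :: "('n::finite \<Rightarrow> nat) \<Rightarrow> real^'n \<Rightarrow> 'b::euclidean_space"
  assumes f: "f \<in> L2" and A: "derivative_family A" "supported_on (cball 0 r) A"
  shows "(second_difference_sum (correlation f (A k)) y
    \<longlongrightarrow> correlation f (\<lambda>x. \<Sum>i\<in>UNIV. A (inc i (inc i k)) x) y) (at_right 0)"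
proof -
  define g where "g = (\<lambda>h x. \<Sum>i\<in>UNIV. (A k (x - y + h *\<^sub>R axis i 1) + A k (x - y - h *\<^sub>R axis i 1)
      - 2 *\<^sub>R A k (x - y)) /\<^sub>R h\<^sup>2)"
  obtain M0 where M0: "M0 \<ge> 0" "bounded_kernel M0 r (A k)"
    using derivative_family_bounded_kernel[OF A] by blast
  have "\<exists>M. M \<ge> 0 \<and> bounded_kernel M r (A (inc i (inc i k)))" for i
    using derivative_family_bounded_kernel[OF A] by metis
  then obtain M where M: "\<And>i. M i \<ge> 0" "\<And>i. bounded_kernel (M i) r (A (inc i (inc i k)))" by metis
  have int: "integrable lebesgue (\<lambda>x. f x \<bullet> A k (x - y'))" for y'
    by (rule correlation_integrable[OF f M0(2)])
  have int2: "integrable lebesgue (\<lambda>x. f x \<bullet> A k (x - y + h *\<^sub>R axis i 1))"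
    "integrable lebesgue (\<lambda>x. f x \<bullet> A k (x - y - h *\<^sub>R axis i 1))" for h and i :: 'n
    using int[of "y - h *\<^sub>R axis i 1"] int[of "y + h *\<^sub>R axis i 1"] by (simp_all add: algebra_simps)
  have meas: "(\<lambda>x. A k (x - y')) \<in> borel_measurable lebesgue" for y'
    by (rule bounded_kernel_shift_measurable[OF M0(2)])
  have meas2: "(\<lambda>x. A k (x - y + h *\<^sub>R axis i 1)) \<in> borel_measurable lebesgue"
    "(\<lambda>x. A k (x - y - h *\<^sub>R axis i 1)) \<in> borel_measurable lebesgue" for h and i :: 'n
    using meas[of "y - h *\<^sub>R axis i 1"] meas[of "y + h *\<^sub>R axis i 1"] by (simp_all add: algebra_simps)
  have eq: "second_difference_sum (correlation f (A k)) y h = (LINT x|lebesgue. f x \<bullet> g h x)" for h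
  proof -
    have shift: "x - (y + v) = x - y - v" "x - (y - v) = x - y + v" for x v :: "real^'n" by simp_all
    have "(LINT x|lebesgue. f x \<bullet> g h x)
      = (LINT x|lebesgue. (\<Sum>i\<in>UNIV. (f x \<bullet> A k (x - y + h *\<^sub>R axis i 1) + f x \<bullet> A k (x - y - h *\<^sub>R axis i 1)
          - 2 * (f x \<bullet> A k (x - y))) / h\<^sup>2))"
      by (simp add: g_def inner_sum_right inner_add_right inner_diff_right divide_inverse mult.commute)
    also have "\<dots> = (\<Sum>i\<in>UNIV. ((LINT x|lebesgue. f x \<bullet> A k (x - y + h *\<^sub>R axis i 1))
        + (LINT x|lebesgue. f x \<bullet> A k (x - y - h *\<^sub>R axis i 1))
        - 2 * (LINT x|lebesgue. f x \<bullet> A k (x - y))) / h\<^sup>2)"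
      using int int2 by (subst Bochner_Integration.integral_sum) auto
    also have "\<dots> = second_difference_sum (correlation f (A k)) y h"
      by (simp add: second_difference_sum_def correlation_def shift sum_divide_distrib add.commute)
    finally show ?thesis by simp
  qed
  have "((\<lambda>h. LINT x|lebesgue. f x \<bullet> g h x)
      \<longlongrightarrow> (LINT x|lebesgue. f x \<bullet> (\<Sum>i\<in>UNIV. A (inc i (inc i k)) (x - y)))) (at_right 0)"
  proof (rule integral_inner_tendsto[OF f])
    show "g h \<in> borel_measurable lebesgue" for h
      unfolding g_def by (intro borel_measurable_sum borel_measurable_scaleR borel_measurable_diff
          borel_measurable_add borel_measurable_const meas meas2)
    show "(\<lambda>x. \<Sum>i\<in>UNIV. A (inc i (inc i k)) (x - y)) \<in> borel_measurable lebesgue"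
      by (intro borel_measurable_sum bounded_kernel_shift_measurable[OF M(2)])
    show "((\<lambda>h. g h x) \<longlongrightarrow> (\<Sum>i\<in>UNIV. A (inc i (inc i k)) (x - y))) (at_right 0)" for x
      unfolding g_def by (intro tendsto_sum derivative_family_second_difference_limit A)
    have "\<forall>\<^sub>F h in at_right 0. h \<in> {0<..<(1::real)}" by (rule eventually_at_right_real) simp
    \<comment> \<open>Each direction contributes 2 \<open>M i\<close>, from the second difference
      bound with c = 0. Since h < 1, the shifted kernels stay within radius r + 1.\<close>
    then show "\<forall>\<^sub>F h in at_right 0. \<forall>x. norm (g h x) \<le> (\<Sum>i\<in>UNIV. 2 * M i) * indicator (cball y (r + 1)) x"
    proof eventually_elim
      case (elim h)
      show ?case
      proof
        fix x
        show "norm (g h x) \<le> (\<Sum>i\<in>UNIV. 2 * M i) * indicator (cball y (r + 1)) x"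
        proof (cases "x \<in> cball y (r + 1)")
          case True
          have "norm (g h x) \<le> (\<Sum>i\<in>UNIV. 2 * M i)"
            unfolding g_def
          proof (intro sum_norm_le)
            fix i
            let ?D = "A k (x - y + h *\<^sub>R axis i 1) + A k (x - y - h *\<^sub>R axis i 1) - 2 *\<^sub>R A k (x - y)"
            have "norm (A (inc i (inc i k)) w - 0) \<le> M i" for w
            proof -
              have "norm (A (inc i (inc i k)) w) \<le> M i * indicator (cball 0 r) w"
                using M(2)[of i] by (simp add: bounded_kernel_def)
              also have "\<dots> \<le> M i" using M(1)[of i] by (simp add: indicator_def)
              finally show ?thesis by simp
            qed
            then have "norm (?D - h\<^sup>2 *\<^sub>R 0) \<le> 2 * M i * h\<^sup>2"
              using elim by (intro derivative_family_second_difference[OF A(1)]) auto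
            then have "norm ?D / h\<^sup>2 \<le> 2 * M i"
              using elim by (simp only: pos_divide_le_eq zero_less_power greaterThanLessThan_iff
                  scaleR_zero_right diff_zero)
            then show "norm (?D /\<^sub>R h\<^sup>2) \<le> 2 * M i"
              by (simp only: norm_scaleR) (simp add: divide_inverse mult.commute)
          qed
          then show ?thesis using True by simp
        next
          case False
          have zero: "A k (x - y + v) = 0" if "norm v \<le> 1" for v
          proof -
            have "norm (x - y) > r + 1" using False by (simp add: dist_norm norm_minus_commute)
            then have "norm (x - y + v) > r"
              using that norm_triangle_ineq4[of "x - y + v" v] by simp
            then have "x - y + v \<notin> cball 0 r" by simp
            then show ?thesis using A(2) by (simp add: supported_on_def)
          qed
          have "A k (x - y + h *\<^sub>R axis i 1) = 0" "A k (x - y - h *\<^sub>R axis i 1) = 0" "A k (x - y) = 0" for i :: 'n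
            using zero[of "h *\<^sub>R axis i 1"] zero[of "- (h *\<^sub>R axis i 1)"] zero[of 0] elim
            by (simp_all add: norm_axis_1)
          then show ?thesis using False by (simp add: g_def)
        qed
      qed
    qed
  qed
  then show ?thesis unfolding eq[abs_def] correlation_def .
qed

section \<open>The time variable\<close>

text \<open>\<open>\<theta> 0\<close> is the integral of \<open>\<beta> 0\<close> from t to c. It
  vanishes from \<open>c\<close> on and is constant to the left of \<open>a\<close>, in general not
  0, which is allowed at time 0.\<close>

lemma bump_antiderivative:
  assumes \<beta>: "bump_sequence a c \<beta>"
  obtains \<theta> where "derivative_sequence \<theta>" "\<And>t. \<theta> (Suc 0) t = - \<beta> 0 t" "\<And>t. t \<ge> c \<Longrightarrow> \<theta> 0 t = 0"
proof -
  have d: "(\<beta> k has_real_derivative \<beta> (Suc k) t) (at t)" for k t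
    using \<beta> by (simp add: bump_sequence_def derivative_sequence_def)
  have "\<exists>F. \<forall>x. - \<infinity> < ereal x \<longrightarrow> ereal x < \<infinity> \<longrightarrow> (F has_vector_derivative \<beta> 0 x) (at x)"
    by (intro einterval_antiderivative) (auto intro: DERIV_isCont[OF d])
  then obtain F where F: "\<And>x. (F has_real_derivative \<beta> 0 x) (at x)"
    by (auto simp: has_real_derivative_iff_has_vector_derivative)
  define \<theta> where "\<theta> = (\<lambda>m t. case m of 0 \<Rightarrow> F c - F t | Suc k \<Rightarrow> - \<beta> k t)"
  show ?thesis
  proof
    show "derivative_sequence \<theta>"
      unfolding derivative_sequence_def
    proof (intro allI)
      fix m t
      show "(\<theta> m has_real_derivative \<theta> (Suc m) t) (at t)"
        by (cases m) (auto simp: \<theta>_def intro!: derivative_eq_intros F d)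
    qed
    show "\<theta> (Suc 0) t = - \<beta> 0 t" for t by (simp add: \<theta>_def)
    show "\<theta> 0 t = 0" if "t \<ge> c" for t
    proof (cases "t = c")
      case False
      then have "c < t" using that by simp
      then have "F t = F c"
      proof (rule DERIV_isconst2[where b = t])
        show "continuous_on {c..t} F" using F by (meson DERIV_isCont continuous_at_imp_continuous_on)
        show "(F has_real_derivative 0) (at x)" if "c < x" "x < t" for x
          using F[of x] that \<beta> by (simp add: bump_sequence_def)
      qed (use \<open>c < t\<close> in auto)
      then show ?thesis by (simp add: \<theta>_def)
    qed (simp add: \<theta>_def)
  qed
qed

text \<open>A du Bois-Reymond argument: the continuous function D = W - \<integral> V integrates to
  0 against every bump. There is no additive constant, because the factors \<open>\<theta>\<close>
  do not vanish at 0.\<close>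

lemma weak_time_derivative:
  fixes W V :: "real \<Rightarrow> real"
  assumes W: "continuous_on {0..<T} W" and V: "continuous_on {0..<T} V"
    and weak: "\<And>\<theta> c. \<lbrakk>derivative_sequence \<theta>; c < T; \<And>t. t \<ge> c \<Longrightarrow> \<theta> 0 t = 0\<rbrakk> \<Longrightarrow>
      (LINT t:{0..<T}|lebesgue. \<theta> (Suc 0) t * W t + \<theta> 0 t * V t) = 0"
    and t: "t \<in> {0..<T}"
  shows "W t = integral {0..t} V"
proof -
  define P where "P = (\<lambda>t. integral {0..t} V)"
  define D where "D = (\<lambda>t. W t - P t)"
  have dP: "(P has_real_derivative V s) (at s within {0..b})" if "b < T" "s \<in> {0..b}" for s b
    unfolding P_def has_real_derivative_iff_has_vector_derivative
    using that by (intro integral_has_vector_derivative continuous_on_subset[OF V]) auto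
  have contP: "continuous_on {0..b} P" if "b < T" for b
    using dP[OF that] by (meson DERIV_continuous_on)
  have contW: "continuous_on {0..b} W" and contV: "continuous_on {0..b} V" if "b < T" for b
    using that by (auto intro: continuous_on_subset[OF W] continuous_on_subset[OF V])
  have contD: "continuous_on {0..b} D" if "b < T" for b
    unfolding D_def using that by (intro continuous_intros contW contP)
  have interior: "D s0 = 0" if s0: "0 < s0" "s0 < T" for s0
  proof (rule ccontr)
    assume ne: "D s0 \<noteq> 0"
    \<comment> \<open>Multiplying by the sign of D(s0) treats both signs at once.\<close>
    define \<sigma> where "\<sigma> = sgn (D s0)"
    define b where "b = (s0 + T) / 2"
    have b: "s0 < b" "b < T" using s0 by (auto simp: b_def)
    have "isCont D s0"
      using contD[OF b(2)] s0 b by (intro continuous_on_interior[of "{0..b}"]) auto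
    then have "isCont (\<lambda>s. \<sigma> * D s) s0" by (intro continuous_intros)
    moreover have "\<sigma> * D s0 > 0" using ne by (simp add: \<sigma>_def sgn_real_def)
    ultimately have "\<forall>\<^sub>F s in nhds s0. \<sigma> * D s > 0"
      by (intro order_tendstoD) (auto simp: continuous_at tendsto_nhds_iff isCont_def tendsto_at_iff_tendsto_nhds)
    then obtain e where e: "e > 0" "\<And>s. dist s s0 < e \<Longrightarrow> \<sigma> * D s > 0"
      by (auto simp: eventually_nhds_metric)
    \<comment> \<open>Half of each distance keeps [a, c] within the region where \<sigma> D is
      positive and strictly between 0 and T.\<close>
    define d where "d = min (e / 2) (min (s0 / 2) ((T - s0) / 2))"
    define a c where "a = s0 - d" and "c = s0 + d"
    have "d \<le> e / 2" "d \<le> s0 / 2" "d \<le> (T - s0) / 2" "d > 0" using e s0 by (auto simp: d_def min_def)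
    then have ac: "0 < a" "a < s0" "s0 < c" "c < T" and pos: "\<And>s. s \<in> {a..c} \<Longrightarrow> \<sigma> * D s > 0"
      using e s0 by (auto simp: a_def c_def dist_real_def)
    define \<beta> where "\<beta> = interval_bump 1 a c"
    have bs: "bump_sequence a c \<beta>" unfolding \<beta>_def using ac by (intro bump_sequence_interval_bump) auto
    then obtain \<theta> where \<theta>: "derivative_sequence \<theta>" "\<And>t. \<theta> (Suc 0) t = - \<beta> 0 t" "\<And>t. t \<ge> c \<Longrightarrow> \<theta> 0 t = 0"
      using bump_antiderivative by blast
    have c\<theta>: "continuous_on S (\<theta> m)" for S m by (rule derivative_sequence_continuous[OF \<theta>(1)])
    have c\<beta>: "continuous_on S (\<beta> m)" for S m
      using bs by (intro derivative_sequence_continuous) (simp add: bump_sequence_def)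
    let ?g = "\<lambda>t. \<theta> (Suc 0) t * W t + \<theta> 0 t * V t"
    have contg: "continuous_on {0..c} ?g"
      by (intro continuous_intros c\<theta> contW contV ac)
    have "0 = (LINT t:{0..<T}|lebesgue. ?g t)" using weak[OF \<theta>(1) ac(4) \<theta>(3)] by simp
    also have "\<dots> = (LINT t:{0..c}|lebesgue. ?g t)"
      unfolding set_lebesgue_integral_def
    proof (rule Bochner_Integration.integral_cong[OF refl])
      fix t
      have "?g t = 0" if "t > c" using that \<theta>(2,3)[of t] bs by (simp add: bump_sequence_def)
      then show "indicator {0..<T} t *\<^sub>R ?g t = indicator {0..c} t *\<^sub>R ?g t"
        using ac by (cases "t > c") (auto simp: indicator_def)
    qed
    also have "\<dots> = integral {0..c} ?g"
      using contg by (intro set_lebesgue_integral_eq_integral absolutely_integrable_continuous_real)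
    finally have i1: "integral {0..c} ?g = 0" by simp
    \<comment> \<open>Integrating \<open>\<theta> V\<close> by parts turns the hypothesis into \<open>\<integral> \<beta> D = 0\<close>.\<close>
    have i2: "((\<lambda>t. \<theta> (Suc 0) t * P t + \<theta> 0 t * V t) has_integral (\<theta> 0 c * P c - \<theta> 0 0 * P 0)) {0..c}"
    proof (rule fundamental_theorem_of_calculus)
      show "0 \<le> c" using ac by simp
      fix t assume t: "t \<in> {0..c}"
      have "(\<theta> 0 has_real_derivative \<theta> (Suc 0) t) (at t within {0..c})"
        using \<theta>(1) by (simp add: derivative_sequence_def has_field_derivative_at_within)
      from DERIV_mult[OF this dP[OF ac(4) t]]
      show "((\<lambda>t. \<theta> 0 t * P t) has_vector_derivative \<theta> (Suc 0) t * P t + \<theta> 0 t * V t) (at t within {0..c})"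
        by (simp add: has_real_derivative_iff_has_vector_derivative[symmetric] mult.commute)
    qed
    have "\<theta> 0 c = 0" "P 0 = 0" using \<theta>(3)[of c] by (simp_all add: P_def)
    with i2 have i3: "((\<lambda>t. \<theta> (Suc 0) t * P t + \<theta> 0 t * V t) has_integral 0) {0..c}" by simp
    have "(?g has_integral 0) {0..c}"
      using i1 contg by (metis integrable_continuous_real integrable_integral)
    from has_integral_diff[OF i3 this]
    have "((\<lambda>t. \<beta> 0 t * D t) has_integral 0) {0..c}"
      by (simp add: D_def \<theta>(2) algebra_simps)
    from has_integral_mult_right[OF this, of \<sigma>]
    have "((\<lambda>t. \<sigma> * (\<beta> 0 t * D t)) has_integral 0) {0..c}" by simp
    then have "integral {0..c} (\<lambda>t. \<sigma> * (\<beta> 0 t * D t)) = 0" by (rule integral_unique)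
    moreover have "continuous_on {0..c} (\<lambda>t. \<sigma> * (\<beta> 0 t * D t))"
      by (intro continuous_intros c\<beta> contD ac)
    moreover have "\<sigma> * (\<beta> 0 t * D t) \<ge> 0" if "t \<in> {0..c}" for t
    proof (cases "t \<in> {a..c}")
      case True
      have "\<beta> 0 t \<ge> 0" by (simp add: \<beta>_def interval_bump_0)
      then have "\<beta> 0 t * (\<sigma> * D t) \<ge> 0" using pos[OF True] by simp
      then show ?thesis by (simp add: mult_ac)
    next
      case False
      then show ?thesis using bs by (simp add: bump_sequence_def)
    qed
    ultimately have "\<sigma> * (\<beta> 0 s0 * D s0) = 0"
      using integral_eq_0_iff[of 0 c "\<lambda>t. \<sigma> * (\<beta> 0 t * D t)"] ac by auto
    moreover have "\<beta> 0 s0 > 0" using ac by (simp add: \<beta>_def interval_bump_0)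
    moreover have "\<sigma> * D s0 > 0" using pos ac by simp
    ultimately show False by auto
  qed
  have "D t = 0"
  proof (cases "t = 0")
    case True
    \<comment> \<open>The bumps only reach interior times; time 0 follows since D is continuous up
      to it. The bound T/2 merely keeps the closure below T.\<close>
    have cl: "closure {0<..<T/2} = {0..T/2}" using t by simp
    have "continuous_on (closure {0<..<T/2}) D" unfolding cl using t by (intro contD) auto
    moreover have "t \<in> closure {0<..<T/2}" unfolding cl using True t by simp
    moreover have "D s = 0" if "s \<in> {0<..<T/2}" for s using that t by (intro interior) auto
    ultimately show ?thesis using continuous_constant_on_closure by metis
  next
    case False
    then show ?thesis using t by (intro interior) auto
  qed
  then show ?thesis by (simp add: D_def P_def)
qed

section \<open>Vanishing of the correlations\<close>

lemma L2_norm_minus_commute: "L2_norm (\<lambda>x. f x - g x) = L2_norm (\<lambda>x. g x - f x)"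
  by (simp add: L2_norm_def norm_minus_commute)

lemma L2_norm_triangle_sub:
  assumes f: "f \<in> L2" and g: "g \<in> L2"
  shows "L2_norm f \<le> L2_norm g + L2_norm (\<lambda>x. f x - g x)"
proof -
  define d where "d = (\<lambda>x. f x - g x)"
  have d: "d \<in> L2" unfolding d_def by (rule L2_diff[OF f g])
  have "(norm (f x))\<^sup>2 = (norm (g x))\<^sup>2 + 2 * (g x \<bullet> d x) + (norm (d x))\<^sup>2" for x
    unfolding power2_norm_eq_inner d_def
    by (simp add: inner_diff inner_commute algebra_simps)
  then have "(L2_norm f)\<^sup>2 = (L2_norm g)\<^sup>2 + 2 * (LINT x|lebesgue. g x \<bullet> d x) + (L2_norm d)\<^sup>2"
    using L2_integrable[OF g] L2_integrable[OF d] L2_inner_integrable[OF g d]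
    by (simp add: L2_norm_power2)
  also have "\<dots> \<le> (L2_norm g + L2_norm d)\<^sup>2"
    using L2_Cauchy_Schwarz[OF g d] by (simp add: power2_sum)
  finally show ?thesis
    unfolding d_def by (rule power2_le_imp_le) (simp add: L2_norm_nonneg)
qed

lemma continuous_into_L2_L2: "continuous_into_L2 I u \<Longrightarrow> t \<in> I \<Longrightarrow> u t \<in> L2"
  by (simp add: continuous_into_L2_def)

lemma continuous_into_L2_eps:
  assumes u: "continuous_into_L2 I u" and t: "t \<in> I" and "\<epsilon> > 0"
  obtains d where "d > 0" "\<And>s. s \<in> I \<Longrightarrow> dist s t < d \<Longrightarrow> L2_norm (\<lambda>x. u s x - u t x) < \<epsilon>"
proof -
  have "((\<lambda>s. L2_norm (\<lambda>x. u s x - u t x)) \<longlongrightarrow> 0) (at t within I)"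
    using u t by (simp add: continuous_into_L2_def)
  then have "\<forall>\<^sub>F s in at t within I. L2_norm (\<lambda>x. u s x - u t x) < \<epsilon>"
    using \<open>\<epsilon> > 0\<close> by (rule order_tendstoD)
  then obtain d where d: "d > 0"
      "\<And>s. s \<in> I \<Longrightarrow> s \<noteq> t \<Longrightarrow> dist s t < d \<Longrightarrow> L2_norm (\<lambda>x. u s x - u t x) < \<epsilon>"
    by (auto simp: eventually_at)
  have "L2_norm (\<lambda>x. u t x - u t x) < \<epsilon>" using \<open>\<epsilon> > 0\<close> by (simp add: L2_norm_def)
  then show ?thesis using that[OF d(1)] d(2) by blast
qed

lemma continuous_into_L2_norm:
  assumes u: "continuous_into_L2 I u"
  shows "continuous_on I (\<lambda>t. L2_norm (u t))"
  unfolding continuous_on_iff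
proof (intro ballI allI impI)
  fix t and \<epsilon> :: real assume t: "t \<in> I" and "\<epsilon> > 0"
  then obtain d where d: "d > 0" "\<And>s. s \<in> I \<Longrightarrow> dist s t < d \<Longrightarrow> L2_norm (\<lambda>x. u s x - u t x) < \<epsilon>"
    using continuous_into_L2_eps[OF u] by blast
  have "dist (L2_norm (u s)) (L2_norm (u t)) < \<epsilon>" if s: "s \<in> I" "dist s t < d" for s
    using d(2)[OF s] L2_norm_triangle_sub[of "u s" "u t"] L2_norm_triangle_sub[of "u t" "u s"]
      L2_norm_minus_commute[of "u s" "u t"]
      continuous_into_L2_L2[OF u s(1)] continuous_into_L2_L2[OF u t] by (simp add: dist_real_def)
  then show "\<exists>d>0. \<forall>s\<in>I. dist s t < d \<longrightarrow> dist (L2_norm (u s)) (L2_norm (u t)) < \<epsilon>"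
    using d(1) by blast
qed

text \<open>The increment is split in two: replacing u(t) by u(t0) costs an amount uniform in
  \<open>y\<close>, by the correlation bound, and for the fixed function u(t0) continuity in
  \<open>y\<close> is known.\<close>

lemma correlation_jointly_continuous:
  fixes u :: "real \<Rightarrow> 'a::euclidean_space \<Rightarrow> 'b::euclidean_space"
  assumes u: "continuous_into_L2 I u" and g: "bounded_kernel M r g"
  shows "continuous_on (UNIV \<times> I) (\<lambda>z. correlation (u (snd z)) g (fst z))"
  unfolding continuous_on_iff
proof (intro ballI allI impI)
  fix z0 :: "'a \<times> real" and \<epsilon> :: real assume z0: "z0 \<in> UNIV \<times> I" and \<epsilon>: "\<epsilon> > 0"
  obtain y0 t0 where z0': "z0 = (y0, t0)" by (cases z0)
  have t0: "t0 \<in> I" using z0 z0' by simp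
  \<comment> \<open>The added 1 allows division by K even when the kernel norm is 0.\<close>
  define K where "K = kernel_norm M r TYPE('a) + 1"
  have K: "K > 0" "kernel_norm M r TYPE('a) \<le> K"
    by (simp_all add: K_def kernel_norm_def add_nonneg_pos)
  have "\<epsilon> / (2 * K) > 0" using \<epsilon> K by simp
  then obtain d1 where d1: "d1 > 0"
    "\<And>s. s \<in> I \<Longrightarrow> dist s t0 < d1 \<Longrightarrow> L2_norm (\<lambda>x. u s x - u t0 x) < \<epsilon> / (2 * K)"
    using continuous_into_L2_eps[OF u t0] by blast
  have "continuous_on UNIV (correlation (u t0) g)"
    by (rule correlation_continuous[OF continuous_into_L2_L2[OF u t0] g])
  then have "\<exists>d>0. \<forall>y. dist y y0 < d \<longrightarrow> dist (correlation (u t0) g y) (correlation (u t0) g y0) < \<epsilon> / 2"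
    unfolding continuous_on_iff using \<epsilon> by (metis UNIV_I half_gt_zero)
  then obtain d2 where d2: "d2 > 0"
    "\<And>y. dist y y0 < d2 \<Longrightarrow> dist (correlation (u t0) g y) (correlation (u t0) g y0) < \<epsilon> / 2"
    by blast
  show "\<exists>d>0. \<forall>z\<in>UNIV \<times> I. dist z z0 < d \<longrightarrow>
      dist (correlation (u (snd z)) g (fst z)) (correlation (u (snd z0)) g (fst z0)) < \<epsilon>"
  proof (intro exI[of _ "min d1 d2"] conjI ballI impI)
    fix z assume z: "z \<in> UNIV \<times> I" "dist z z0 < min d1 d2"
    obtain y t where z': "z = (y, t)" by (cases z)
    have t: "t \<in> I" and dt: "dist t t0 < d1" and dy: "dist y y0 < d2"
      using z dist_snd_le[of z z0] dist_fst_le[of z z0] by (auto simp: z' z0')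
    have "\<bar>correlation (u t) g y - correlation (u t0) g y\<bar>
        \<le> L2_norm (\<lambda>x. u t x - u t0 x) * kernel_norm M r TYPE('a)"
      unfolding correlation_diff[OF continuous_into_L2_L2[OF u t] continuous_into_L2_L2[OF u t0] g]
      by (intro correlation_bound[OF _ g] L2_diff continuous_into_L2_L2[OF u] t t0)
    also have "\<dots> \<le> L2_norm (\<lambda>x. u t x - u t0 x) * K"
      by (intro mult_left_mono K L2_norm_nonneg)
    also have "\<dots> \<le> \<epsilon> / (2 * K) * K"
      using d1(2)[OF t dt] K by (intro mult_right_mono) auto
    also have "\<dots> = \<epsilon> / 2" using K by simp
    finally have "\<bar>correlation (u t) g y - correlation (u t0) g y\<bar> \<le> \<epsilon> / 2" .
    then have "\<bar>correlation (u t) g y - correlation (u t0) g y0\<bar> < \<epsilon>"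
      using d2(2)[OF dy] unfolding dist_real_def by linarith
    then show "dist (correlation (u (snd z)) g (fst z)) (correlation (u (snd z0)) g (fst z0)) < \<epsilon>"
      by (simp add: z' z0' dist_real_def)
  qed (use d1 d2 in auto)
qed

section \<open>Heat evolution of correlations with divergence-free kernels\<close>

lemma derivative_family_shift:
  fixes A :: "('n::finite \<Rightarrow> nat) \<Rightarrow> real^'n \<Rightarrow> 'b::euclidean_space"
  assumes "derivative_family A"
  shows "derivative_family (\<lambda>k x. A k (x - y))"
  unfolding derivative_family_def
proof (intro allI)
  fix k x
  have "((\<lambda>x. x - y) has_derivative (\<lambda>v. v)) (at x)" by (auto intro!: derivative_eq_intros)
  moreover have "(A k has_derivative (\<lambda>v. \<Sum>j\<in>UNIV. (v $ j) *\<^sub>R A (inc j k) (x - y))) (at (x - y))"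
    using assms by (simp add: derivative_family_def)
  ultimately show "((\<lambda>x. A k (x - y)) has_derivative
      (\<lambda>v. \<Sum>j\<in>UNIV. (v $ j) *\<^sub>R A (inc j k) (x - y))) (at x)"
    by (rule has_derivative_compose)
qed

lemma supported_on_shift:
  fixes A :: "'i \<Rightarrow> 'a::euclidean_space \<Rightarrow> 'b::zero"
  assumes "supported_on (cball 0 r) A"
  shows "supported_on (cball y r) (\<lambda>k x. A k (x - y))"
  using assms by (auto simp: supported_on_def dist_norm norm_minus_commute)

lemma derivative_family_laplacian:
  fixes A :: "('n::finite \<Rightarrow> nat) \<Rightarrow> real^'n \<Rightarrow> 'b::euclidean_space"
  assumes "derivative_family A"
  shows "derivative_family (\<lambda>k x. \<Sum>i\<in>UNIV. A (inc i (inc i k)) x)"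
  using assms
  by (intro derivative_family_sum derivative_family_inc[where A = "\<lambda>k. A (inc _ k)"] derivative_family_inc) auto

lemma supported_on_laplacian:
  "supported_on K A \<Longrightarrow> supported_on K (\<lambda>k x. \<Sum>i\<in>UNIV. A (inc i (inc i k)) x)"
  by (simp add: supported_on_def)

text \<open>With \<open>y\<close> as a parameter, the test field \<theta>(t) B(x - y) removes the
  pressure pointwise and leaves a scalar weak equation in t. Its solution W(y, t) is the time
  integral of V(y, .), and V is also the Laplacian of W in \<open>y\<close>.\<close>

lemma weak_heat_correlation_nonpos:
  fixes u :: "real \<Rightarrow> real^'n::finite \<Rightarrow> real^'n" and p :: "(real^'n) \<times> real \<Rightarrow> real"
  assumes u: "continuous_into_L2 {0..<T} u"
    and weak: "\<And>\<phi> :: (real^'n) \<times> real \<Rightarrow> real^'n. \<phi> \<in> test_functions (UNIV \<times> {0..<T}) \<Longrightarrow>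
           (LINT t:{0..<T}|lebesgue. (LINT x|lebesgue.
              (vector_derivative (\<lambda>s. \<phi> (x, s)) (at t within {0..<T})
                 + laplacian (\<lambda>y. \<phi> (y, t)) x) \<bullet> u t x
              + p (x, t) * divergence (\<lambda>y. \<phi> (y, t)) x)) = 0"
    and B: "derivative_family B" "supported_on (cball 0 r) B"
    and div: "\<And>c y x. divergence (\<lambda>z. c *\<^sub>R B k (z - y)) x = 0"
    and t: "t \<in> {0..<T}"
  shows "correlation (u t) (B k) y \<le> 0"
proof -
  define L where "L = (\<lambda>k x. \<Sum>i\<in>UNIV. B (inc i (inc i k)) x)"
  have L: "derivative_family L" "supported_on (cball 0 r) L"
    unfolding L_def by (rule derivative_family_laplacian[OF B(1)], rule supported_on_laplacian[OF B(2)])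
  define W V where "W = (\<lambda>y t. correlation (u t) (B k) y)" and "V = (\<lambda>y t. correlation (u t) (L k) y)"
  obtain M where M: "bounded_kernel M r (B k)" using derivative_family_bounded_kernel[OF B] by blast
  obtain M' where M': "bounded_kernel M' r (L k)" using derivative_family_bounded_kernel[OF L] by blast
  have slice: "continuous_on {0..<T} (\<lambda>t. correlation (u t) g y)" if "bounded_kernel m r g" for g m y
  proof -
    have "continuous_on {0..<T} (Pair y)" by (intro continuous_intros)
    moreover have "Pair y ` {0..<T} \<subseteq> UNIV \<times> {0..<T}" by auto
    ultimately show ?thesis
      using continuous_on_compose2[OF correlation_jointly_continuous[OF u that], of "{0..<T}" "Pair y"]
      by simp
  qed
  have Wint: "W y t = integral {0..t} (V y)" if "t \<in> {0..<T}" for y t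
  proof (rule weak_time_derivative[OF _ _ _ that])
    show "continuous_on {0..<T} (W y)" unfolding W_def by (rule slice[OF M])
    show "continuous_on {0..<T} (V y)" unfolding V_def by (rule slice[OF M'])
    fix \<theta> c
    assume \<theta>: "derivative_sequence \<theta>" "c < T" "\<And>t. t \<ge> c \<Longrightarrow> \<theta> 0 t = 0"
    define By where "By = (\<lambda>k x. B k (x - y))"
    have By: "derivative_family By" "supported_on (cball y r) By"
      unfolding By_def by (rule derivative_family_shift[OF B(1)], rule supported_on_shift[OF B(2)])
    define \<phi> where "\<phi> = (\<lambda>z. \<theta> 0 (snd z) *\<^sub>R By k (fst z))"
    have "\<phi> \<in> test_functions (UNIV \<times> {0..<T})"
      unfolding \<phi>_def by (rule separated_test_function[OF By compact_cball \<theta>(1,3,2)])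
    note eq = weak[OF this]
    have inner: "(LINT x|lebesgue. (vector_derivative (\<lambda>s. \<phi> (x, s)) (at t within {0..<T})
          + laplacian (\<lambda>y. \<phi> (y, t)) x) \<bullet> u t x + p (x, t) * divergence (\<lambda>y. \<phi> (y, t)) x)
        = \<theta> (Suc 0) t * W y t + \<theta> 0 t * V y t" if t: "t \<in> {0..<T}" for t
    proof -
      have ut: "u t \<in> L2" by (rule continuous_into_L2_L2[OF u t])
      have "vector_derivative (\<lambda>s. \<phi> (x, s)) (at t within {0..<T}) = \<theta> (Suc 0) t *\<^sub>R B k (x - y)" for x
      proof (rule vector_derivative_within)
        show "at t within {0..<T} \<noteq> bot"
          using t by (auto simp: trivial_limit_within islimpt_Ico)
        have "(\<theta> 0 has_real_derivative \<theta> (Suc 0) t) (at t within {0..<T})"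
          using \<theta>(1) by (simp add: derivative_sequence_def has_field_derivative_at_within)
        then show "((\<lambda>s. \<phi> (x, s)) has_vector_derivative \<theta> (Suc 0) t *\<^sub>R B k (x - y)) (at t within {0..<T})"
          unfolding \<phi>_def By_def by (auto intro!: derivative_eq_intros)
      qed
      moreover have "laplacian (\<lambda>y. \<phi> (y, t)) x = \<theta> 0 t *\<^sub>R L k (x - y)" for x
        using laplacian_family[OF derivative_family_scaleR[OF By(1)], of "\<theta> 0 t" k x]
        by (simp add: \<phi>_def L_def By_def scaleR_sum_right)
      moreover have "divergence (\<lambda>y. \<phi> (y, t)) x = 0" for x
        unfolding \<phi>_def By_def by (simp add: div)
      ultimately have "(LINT x|lebesgue. (vector_derivative (\<lambda>s. \<phi> (x, s)) (at t within {0..<T})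
          + laplacian (\<lambda>y. \<phi> (y, t)) x) \<bullet> u t x + p (x, t) * divergence (\<lambda>y. \<phi> (y, t)) x)
        = (LINT x|lebesgue. \<theta> (Suc 0) t * (u t x \<bullet> B k (x - y)) + \<theta> 0 t * (u t x \<bullet> L k (x - y)))"
        by (simp add: inner_add_left inner_add_right inner_commute)
      also have "\<dots> = \<theta> (Suc 0) t * W y t + \<theta> 0 t * V y t"
        using correlation_integrable[OF ut M] correlation_integrable[OF ut M']
        by (simp add: W_def V_def correlation_def)
      finally show ?thesis .
    qed
    have "(LINT t:{0..<T}|lebesgue. \<theta> (Suc 0) t * W y t + \<theta> 0 t * V y t)
      = (LINT t:{0..<T}|lebesgue. (LINT x|lebesgue.
              (vector_derivative (\<lambda>s. \<phi> (x, s)) (at t within {0..<T})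
                 + laplacian (\<lambda>y. \<phi> (y, t)) x) \<bullet> u t x
              + p (x, t) * divergence (\<lambda>y. \<phi> (y, t)) x))"
      unfolding set_lebesgue_integral_def
    proof (rule Bochner_Integration.integral_cong[OF refl])
      fix t
      show "indicator {0..<T} t *\<^sub>R (\<theta> (Suc 0) t * W y t + \<theta> 0 t * V y t)
        = indicator {0..<T} t *\<^sub>R (LINT x|lebesgue.
              (vector_derivative (\<lambda>s. \<phi> (x, s)) (at t within {0..<T})
                 + laplacian (\<lambda>y. \<phi> (y, t)) x) \<bullet> u t x
              + p (x, t) * divergence (\<lambda>y. \<phi> (y, t)) x)"
        by (cases "t \<in> {0..<T}") (simp only: inner, simp del: atLeastLessThan_iff)
    qed
    then show "(LINT t:{0..<T}|lebesgue. \<theta> (Suc 0) t * W y t + \<theta> 0 t * V y t) = 0"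
      using eq by simp
  qed
  \<comment> \<open>The norm of u may blow up as time tends to T, so the maximum principle is run on
    [0, t], where compactness bounds it.\<close>
  have "continuous_on {0..t} (\<lambda>s. L2_norm (u s))"
    using t by (auto intro: continuous_on_subset[OF continuous_into_L2_norm[OF u]])
  then have "compact ((\<lambda>s. L2_norm (u s)) ` {0..t})" by (intro compact_continuous_image) auto
  then have "\<exists>N. \<forall>s\<in>{0..t}. L2_norm (u s) \<le> N"
    by (auto simp: bounded_iff L2_norm_nonneg dest!: compact_imp_bounded)
  then obtain N where N: "\<And>s. s \<in> {0..t} \<Longrightarrow> L2_norm (u s) \<le> N" by blast
  have "W y t \<le> 0"
  proof (rule heat_maximum_principle[where W = W and V = V and \<tau> = t])
    show "continuous_on (UNIV \<times> {0..t}) (\<lambda>z. W (fst z) (snd z))"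
      unfolding W_def using t
      by (intro continuous_on_subset[OF correlation_jointly_continuous[OF u M]]) auto
    show "W y s \<le> N * kernel_norm M r TYPE(real^'n)" if s: "s \<in> {0..t}" for y s
    proof -
      have "\<bar>W y s\<bar> \<le> L2_norm (u s) * kernel_norm M r TYPE(real^'n)"
        unfolding W_def using s t by (intro correlation_bound[OF _ M] continuous_into_L2_L2[OF u]) auto
      also have "\<dots> \<le> N * kernel_norm M r TYPE(real^'n)"
        by (intro mult_right_mono N[OF s]) (simp add: kernel_norm_def)
      finally show ?thesis by simp
    qed
    \<comment> \<open>At time 0 the integral form runs over a degenerate interval; this is the
      initial condition hidden in the weak equation.\<close>
    show "W y 0 \<le> 0" for y using Wint[of 0 y] t by simp
    show "(second_difference_sum (\<lambda>y. W y s) y \<longlongrightarrow> V y s) (at_right 0)" if "s \<in> {0..t}" for y s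
    proof -
      have "u s \<in> L2" using that t by (intro continuous_into_L2_L2[OF u]) auto
      from correlation_second_difference[OF this B, of k y] show ?thesis
        by (simp add: W_def V_def L_def)
    qed
    show "((\<lambda>\<sigma>. (W y s - W y \<sigma>) / (s - \<sigma>)) \<longlongrightarrow> V y s) (at_left s)" if s: "s \<in> {0<..t}" for y s
    proof -
      have "continuous_on {0..s} (V y)"
        unfolding V_def using s t by (intro continuous_on_subset[OF slice[OF M']]) auto
      then have "((\<lambda>\<sigma>. integral {0..\<sigma>} (V y)) has_vector_derivative V y s) (at s within {0..s})"
        using s by (intro integral_has_vector_derivative) auto
      then have "((\<lambda>\<sigma>. integral {0..\<sigma>} (V y)) has_real_derivative V y s) (at_left s)"
        using s by (simp add: has_real_derivative_iff_has_vector_derivative at_within_Icc_at_left)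
      then have lim: "((\<lambda>\<sigma>. (integral {0..\<sigma>} (V y) - integral {0..s} (V y)) / (\<sigma> - s)) \<longlongrightarrow> V y s) (at_left s)"
        by (simp add: has_field_derivative_iff)
      have "\<forall>\<^sub>F \<sigma> in at_left s. \<sigma> \<in> {0<..<s}" using s by (intro eventually_at_left_real) simp
      then have "\<forall>\<^sub>F \<sigma> in at_left s. (integral {0..\<sigma>} (V y) - integral {0..s} (V y)) / (\<sigma> - s)
          = (W y s - W y \<sigma>) / (s - \<sigma>)"
      proof eventually_elim
        case (elim \<sigma>)
        then show ?case using s t Wint[of \<sigma> y] Wint[of s y]
          by (simp add: minus_divide_divide[symmetric, of "_ - _" "\<sigma> - s"])
      qed
      from Lim_transform_eventually[OF lim this] show ?thesis .
    qed
  qed (use t in auto)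
  then show ?thesis by (simp add: W_def)
qed

text \<open>The one-sided bound holds for every admissible field, so applying it to B and to -B
  gives equality.\<close>

lemma weak_heat_correlation_solenoidal:
  fixes u :: "real \<Rightarrow> real^'n::finite \<Rightarrow> real^'n" and p :: "(real^'n) \<times> real \<Rightarrow> real"
  assumes u: "continuous_into_L2 {0..<T} u"
    and weak: "\<And>\<phi> :: (real^'n) \<times> real \<Rightarrow> real^'n. \<phi> \<in> test_functions (UNIV \<times> {0..<T}) \<Longrightarrow>
           (LINT t:{0..<T}|lebesgue. (LINT x|lebesgue.
              (vector_derivative (\<lambda>s. \<phi> (x, s)) (at t within {0..<T})
                 + laplacian (\<lambda>y. \<phi> (y, t)) x) \<bullet> u t x
              + p (x, t) * divergence (\<lambda>y. \<phi> (y, t)) x)) = 0"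
    and A: "derivative_family A" "supported_on (cball 0 r) A"
    and t: "t \<in> {0..<T}"
  shows "correlation (u t) (solenoidal_field i A k) y = 0"
proof -
  define B where "B = solenoidal_field i A"
  have B: "derivative_family B" "supported_on (cball 0 r) B"
    unfolding B_def by (rule derivative_family_solenoidal_field[OF A(1)], rule supported_on_solenoidal_field[OF A(2)])
  have div: "divergence (\<lambda>z. c *\<^sub>R B k (z - y)) x = 0" for c k y x
    using divergence_solenoidal_field[OF derivative_family_shift[OF A(1), of y], of c i k x]
    by (simp add: B_def solenoidal_field_def)
  have le: "correlation (u t) (B k) y \<le> 0"
    by (rule weak_heat_correlation_nonpos[OF u weak B div t])
  have "correlation (u t) ((\<lambda>k x. (- 1) *\<^sub>R B k x) k) y \<le> 0"
  proof (rule weak_heat_correlation_nonpos[OF u weak])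
    show "derivative_family (\<lambda>k x. (- 1) *\<^sub>R B k x)" by (rule derivative_family_scaleR[OF B(1)])
    show "supported_on (cball 0 r) (\<lambda>k x. (- 1) *\<^sub>R B k x)" using B(2) by (simp add: supported_on_def)
    show "divergence (\<lambda>z. c *\<^sub>R (- 1) *\<^sub>R B k (z - y)) x = 0" for c y x
      using div[of "- c"] by simp
  qed (use t in auto)
  then have "correlation (u t) (B k) y \<ge> 0" by (simp add: correlation_def)
  then show ?thesis using le by (simp add: B_def)
qed

section \<open>Orthogonality to gradients and weak harmonicity\<close>

lemma divergence_free_correlation_gradient:
  assumes v: "weakly_divergence_free v" and A: "derivative_family A" "supported_on (cball 0 r) A"
  shows "correlation v (\<lambda>x. \<chi> j. A (inc j k) x) y = 0"
proof -
  define Ay where "Ay = (\<lambda>k x. A k (x - y))"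
  have Ay: "derivative_family Ay" "supported_on (cball y r) Ay"
    unfolding Ay_def by (rule derivative_family_shift[OF A(1)], rule supported_on_shift[OF A(2)])
  have grad: "gradient (Ay k) x = (\<chi> j. A (inc j k) (x - y))" for x
    unfolding gradient_def partial_deriv_family[OF Ay(1)] by (simp add: Ay_def)
  have "(LINT x|lebesgue. v x \<bullet> gradient (Ay k) x) = 0"
    using v derivative_family_test_function[OF Ay compact_cball] by (simp add: weakly_divergence_free_def)
  then show ?thesis unfolding correlation_def grad .
qed

text \<open>Correlating with a smooth kernel takes the place of a regularity theorem:
  \<open>harm\<close> says that the second differences of the correlation tend to 0, and square
  integrability of \<open>v\<close> supplies the decay.\<close>

lemma weakly_harmonic_correlation_nonpos:
  fixes v :: "real^'n::finite \<Rightarrow> 'b::euclidean_space"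
  assumes v: "v \<in> L2" and E: "derivative_family E" "supported_on (cball 0 r) E"
    and harm: "\<And>y. correlation v (\<lambda>x. \<Sum>j\<in>UNIV. E (inc j (inc j k)) x) y = 0"
  shows "correlation v (E k) y \<le> 0"
proof -
  obtain M where M: "bounded_kernel M r (E k)" using derivative_family_bounded_kernel[OF E] by blast
  show ?thesis
  proof (rule harmonic_maximum_principle)
    show "(second_difference_sum (correlation v (E k)) y \<longlongrightarrow> 0) (at_right 0)" for y
      using correlation_second_difference[OF v E, of k y] harm by simp
  qed (rule correlation_continuous[OF v M], rule correlation_vanishes_at_infinity[OF v M])
qed

lemma weakly_harmonic_correlation_zero:
  fixes v :: "real^'n::finite \<Rightarrow> 'b::euclidean_space"
  assumes v: "v \<in> L2" and E: "derivative_family E" "supported_on (cball 0 r) E"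
    and harm: "\<And>y. correlation v (\<lambda>x. \<Sum>j\<in>UNIV. E (inc j (inc j k)) x) y = 0"
  shows "correlation v (E k) y = 0"
proof -
  have "correlation v ((\<lambda>k x. (- 1) *\<^sub>R E k x) k) y \<le> 0"
  proof (rule weakly_harmonic_correlation_nonpos[OF v])
    show "derivative_family (\<lambda>k x. (- 1) *\<^sub>R E k x)" by (rule derivative_family_scaleR[OF E(1)])
    show "supported_on (cball 0 r) (\<lambda>k x. (- 1) *\<^sub>R E k x)" using E(2) by (simp add: supported_on_def)
    show "correlation v (\<lambda>x. \<Sum>j\<in>UNIV. (- 1) *\<^sub>R E (inc j (inc j k)) x) y = 0" for y
      using harm[of y] by (simp add: correlation_def sum_negf)
  qed
  then show ?thesis
    using weakly_harmonic_correlation_nonpos[OF v E harm, of y] by (simp add: correlation_def)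
qed

text \<open>An explicit Helmholtz splitting of (\<Delta>g) e_i with both parts compactly supported.
  The heat equation annihilates the first part, the divergence constraint the second.\<close>

lemma solenoidal_plus_gradient:
  "solenoidal_field i A k x + (\<chi> j. A (inc j (inc i k)) x) = (\<Sum>j\<in>UNIV. A (inc j (inc j k)) x) *\<^sub>R axis i 1"
  by (simp add: vec_eq_iff solenoidal_field_component axis_def inc_commute[of i])

text \<open>Inside the box each factor is exp(-h/q) with q > 0; outside, one factor is exactly 0.
  The sharpness is written as 1/h so that the limit is at the finite point 0, as
  \<open>integral_inner_tendsto\<close> requires.\<close>

lemma tensor_interval_bump_tendsto_indicator:
  fixes a b :: "real^'n::finite"
  assumes ab: "\<And>j. a $ j \<le> b $ j"
  shows "((\<lambda>h. tensor_product (\<lambda>j. interval_bump (1 / h) (a $ j) (b $ j)) (\<lambda>_. 0) x)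
    \<longlongrightarrow> indicator (box a b) x) (at_right 0)"
proof (cases "x \<in> box a b")
  case True
  have "((\<lambda>h. interval_bump (1 / h) (a $ j) (b $ j) 0 (x $ j)) \<longlongrightarrow> 1) (at_right 0)" for j
  proof -
    define q where "q = (x $ j - a $ j) * (b $ j - x $ j)"
    have q: "q > 0" using True by (simp add: q_def mem_box_cart)
    have "((\<lambda>h. exp (- (h / q))) \<longlongrightarrow> exp (- (0 / q))) (at_right 0)"
      using q by (intro tendsto_intros) auto
    then have lim: "((\<lambda>h. exp (- (h / q))) \<longlongrightarrow> 1) (at_right 0)" by simp
    have "\<forall>\<^sub>F h in at_right (0::real). h > 0" by (rule eventually_at_right_less)
    then have "\<forall>\<^sub>F h in at_right 0. exp (- (h / q)) = interval_bump (1 / h) (a $ j) (b $ j) 0 (x $ j)"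
      by eventually_elim (use q in \<open>simp add: interval_bump_0 q_def[symmetric]\<close>)
    from Lim_transform_eventually[OF lim this] show ?thesis .
  qed
  then have "((\<lambda>h. \<Prod>j\<in>UNIV. interval_bump (1 / h) (a $ j) (b $ j) 0 (x $ j)) \<longlongrightarrow> (\<Prod>j\<in>(UNIV::'n set). 1)) (at_right 0)"
    by (intro tendsto_prod)
  then show ?thesis using True by (simp add: tensor_product_def)
next
  case False
  then obtain j where j: "x $ j \<le> a $ j \<or> b $ j \<le> x $ j" by (auto simp: mem_box_cart not_less)
  have "\<forall>\<^sub>F h in at_right (0::real). h > 0" by (rule eventually_at_right_less)
  then have "\<forall>\<^sub>F h in at_right 0. tensor_product (\<lambda>j. interval_bump (1 / h) (a $ j) (b $ j)) (\<lambda>_. 0) x = 0"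
  proof eventually_elim
    case (elim h)
    have "(x $ j - a $ j) * (b $ j - x $ j) \<le> 0"
      using j ab[of j] by (auto simp: mult_le_0_iff)
    then have "\<not> 1 / h * ((x $ j - a $ j) * (b $ j - x $ j)) > 0"
      using elim by (simp add: zero_less_divide_iff not_less)
    then have "interval_bump (1 / h) (a $ j) (b $ j) 0 (x $ j) = 0"
      unfolding interval_bump_0 by (simp only: if_False)
    then show ?case unfolding tensor_product_def by (meson UNIV_I finite prod_zero)
  qed
  then show ?thesis using False by (simp add: tendsto_eventually)
qed

text \<open>Dominated convergence passes from bumps to boxes, and Lebesgue differentiation from
  boxes to almost every point.\<close>

lemma AE_zero_if_bump_integrals_zero:
  fixes v :: "real^'n::finite \<Rightarrow> 'b::euclidean_space"
  assumes v: "v \<in> L2"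
    and zero: "\<And>a b c. \<lbrakk>\<And>j. a $ j \<le> b $ j; c > 0\<rbrakk> \<Longrightarrow>
      (LINT x|lebesgue. v x \<bullet> (tensor_product (\<lambda>j. interval_bump c (a $ j) (b $ j)) (\<lambda>_. 0) x *\<^sub>R w)) = 0"
  shows "AE x in lebesgue. v x \<bullet> w = 0"
proof -
  have indL2: "(\<lambda>x. indicator S x *\<^sub>R w) \<in> L2" if "S \<in> lmeasurable" "bounded S" for S :: "(real^'n) set"
  proof -
    obtain r where r: "S \<subseteq> cball 0 r" using bounded_subset_ballD[OF \<open>bounded S\<close>] ball_subset_cball by (meson order_trans)
    show ?thesis
    proof (rule bounded_support_L2(1))
      show "(\<lambda>x. indicator S x *\<^sub>R w) \<in> borel_measurable lebesgue"
        using that(1) by (intro borel_measurable_scaleR borel_measurable_indicator borel_measurable_const)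
          (simp add: fmeasurableD)
      show "norm (indicator S x *\<^sub>R w) \<le> norm w * indicator (cball 0 r) x" for x
        using r by (auto simp: indicator_def)
    qed
  qed
  have box_zero: "(LINT x|lebesgue. v x \<bullet> (indicator (box a b) x *\<^sub>R w)) = 0"
    if ab: "\<And>j. a $ j \<le> b $ j" for a b
  proof -
    define g where "g = (\<lambda>h x. tensor_product (\<lambda>j. interval_bump (1 / h) (a $ j) (b $ j)) (\<lambda>_. 0) x *\<^sub>R w)"
    have seq: "derivative_sequence (interval_bump c a b)" for c a b
      unfolding interval_bump_def by (rule derivative_sequence_exp_inverse_bump)
    obtain r where r: "cbox a b \<subseteq> cball 0 r"
      using bounded_subset_ballD[OF bounded_cbox] ball_subset_cball by (meson order_trans)
    have lim: "((\<lambda>h. LINT x|lebesgue. v x \<bullet> g h x) \<longlongrightarrow> (LINT x|lebesgue. v x \<bullet> (indicator (box a b) x *\<^sub>R w))) (at_right 0)"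
    proof (rule integral_inner_tendsto[OF v])
      show "g h \<in> borel_measurable lebesgue" for h
      proof -
        have "continuous_on UNIV (g h)"
          unfolding g_def
          by (intro continuous_intros derivative_family_continuous[OF derivative_family_tensor_product] seq)
        then show ?thesis by (intro measurable_completion) (simp add: borel_measurable_continuous_onI)
      qed
      show "(\<lambda>x. indicator (box a b) x *\<^sub>R w) \<in> borel_measurable lebesgue"
        by (intro L2_measurable indL2) auto
      show "((\<lambda>h. g h x) \<longlongrightarrow> indicator (box a b) x *\<^sub>R w) (at_right 0)" for x
        unfolding g_def by (intro tendsto_scaleR tendsto_const tensor_interval_bump_tendsto_indicator ab)
      have "\<forall>\<^sub>F h in at_right (0::real). h > 0" by (rule eventually_at_right_less)
      then show "\<forall>\<^sub>F h in at_right 0. \<forall>x. norm (g h x) \<le> norm w * indicator (cball 0 r) x"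
      proof eventually_elim
        case (elim h)
        let ?t = "tensor_product (\<lambda>j. interval_bump (1 / h) (a $ j) (b $ j)) (\<lambda>_. 0)"
        have sup: "supported_on (cbox a b) (tensor_product (\<lambda>j. interval_bump (1 / h) (a $ j) (b $ j)))"
          using ab elim by (intro supported_on_tensor_product bump_sequence_interval_bump) auto
        show ?case
        proof
          fix x
          have "0 \<le> ?t x" "?t x \<le> 1"
            unfolding tensor_product_def using interval_bump_range
            by (auto intro!: prod_nonneg prod_le_1)
          moreover have "?t x = 0" if "x \<notin> cball 0 r"
            using sup r that unfolding supported_on_def by blast
          ultimately show "norm (g h x) \<le> norm w * indicator (cball 0 r) x"
            unfolding g_def by (auto simp: indicator_def mult_left_le_one_le)
        qed
      qed
    qed
    have "\<forall>\<^sub>F h in at_right (0::real). (LINT x|lebesgue. v x \<bullet> g h x) = 0"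
      using eventually_at_right_less[of "0::real"]
      by eventually_elim (use ab zero in \<open>simp add: g_def\<close>)
    then have "((\<lambda>h. LINT x|lebesgue. v x \<bullet> g h x) \<longlongrightarrow> 0) (at_right 0)"
      by (rule tendsto_eventually)
    from tendsto_unique[OF trivial_limit_at_right_real lim this] show ?thesis .
  qed
  define f where "f = (\<lambda>x. v x \<bullet> w)"
  have sint: "set_integrable lebesgue S f" if "S \<in> lmeasurable" "bounded S" for S
    using L2_inner_integrable[OF v indL2[OF that]] by (simp add: set_integrable_def f_def)
  have int0: "integral (cbox a b) f = 0" if ab: "\<And>j. a $ j \<le> b $ j" for a b
  proof -
    \<comment> \<open>The bumps converge to the indicator of the open box, whereas differentiation
      uses closed boxes; the boundary is negligible.\<close>
    have "integral (cbox a b) f = integral (box a b) f" by (simp add: integral_open_interval)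
    also have "\<dots> = (LINT x:box a b|lebesgue. f x)"
      by (rule set_lebesgue_integral_eq_integral(2)[symmetric], rule sint) auto
    also have "\<dots> = 0" using box_zero[OF ab] by (simp add: set_lebesgue_integral_def f_def)
    finally show ?thesis .
  qed
  have "f integrable_on cbox a b" for a b
    by (rule set_lebesgue_integral_eq_integral(1), rule sint) auto
  \<comment> \<open>Lebesgue differentiation with cubes that have \<open>x\<close> as their lower
    corner.\<close>
  then obtain N where N: "negligible N" "\<And>x e. \<lbrakk>x \<notin> N; 0 < e\<rbrakk> \<Longrightarrow>
      \<exists>d>0. \<forall>h. 0 < h \<and> h < d \<longrightarrow>
        norm (integral (cbox x (x + h *\<^sub>R One)) f /\<^sub>R h ^ DIM(real^'n) - f x) < e"
    using integrable_ccontinuous_explicit[of f] by blast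
  have "f x = 0" if "x \<notin> N" for x
  proof (rule ccontr)
    assume "f x \<noteq> 0"
    then have "norm (f x) > 0" by simp
    from N(2)[OF that this] obtain d where d: "d > 0"
      "\<And>h. 0 < h \<Longrightarrow> h < d \<Longrightarrow> norm (integral (cbox x (x + h *\<^sub>R One)) f /\<^sub>R h ^ DIM(real^'n) - f x) < norm (f x)"
      by blast
    have "(One :: real^'n) $ j = 1" for j
      using inner_sum_left_Basis[of "axis j 1 :: real^'n" "\<lambda>_. 1"]
      by (simp add: inner_axis axis_in_Basis_iff)
    then have "integral (cbox x (x + (d / 2) *\<^sub>R One)) f = 0"
      using d(1) by (intro int0) simp
    then show False using d(2)[of "d / 2"] d(1) by simp
  qed
  then have "{x. f x \<noteq> 0} \<subseteq> N" by blast
  then have "negligible {x. f x \<noteq> 0}" using N(1) negligible_subset by blast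
  then show ?thesis
    unfolding f_def by (simp add: eventually_ae_filter negligible_iff_null_sets) blast
qed

theorem theorem2p5:
  fixes T :: real
    and u :: "real \<Rightarrow> real^3 \<Rightarrow> real^3"
    and p :: "(real^3) \<times> real \<Rightarrow> real"
  assumes "T > 0"
    and "continuous_into_L2 {0..<T} u"
    and "\<And>t. t \<in> {0..<T} \<Longrightarrow> weakly_divergence_free (u t)"
    and "p \<in> L1_loc (UNIV \<times> {0..<T})"
    and "\<And>\<phi> :: (real^3) \<times> real \<Rightarrow> real^3. \<phi> \<in> test_functions (UNIV \<times> {0..<T}) \<Longrightarrow>
           (LINT t:{0..<T}|lebesgue. (LINT x|lebesgue.
              (vector_derivative (\<lambda>s. \<phi> (x, s)) (at t within {0..<T})
                 + laplacian (\<lambda>y. \<phi> (y, t)) x) \<bullet> u t x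
              + p (x, t) * divergence (\<lambda>y. \<phi> (y, t)) x)) = 0"
  shows "\<forall>t\<in>{0..<T}. AE x in lebesgue. u t x = 0"
proof
  fix t assume t: "t \<in> {0..<T}"
  have ut: "u t \<in> L2" by (rule continuous_into_L2_L2[OF assms(2) t])
  have "AE x in lebesgue. u t x \<bullet> axis i 1 = 0" for i
  proof (rule AE_zero_if_bump_integrals_zero[OF ut])
    fix a b :: "real^3" and c :: real
    assume ab: "\<And>j. a $ j \<le> b $ j" and c: "c > 0"
    define A where "A = tensor_product (\<lambda>j. interval_bump c (a $ j) (b $ j))"
    have bs: "bump_sequence (a $ j) (b $ j) (interval_bump c (a $ j) (b $ j))" for j
      by (rule bump_sequence_interval_bump[OF c ab])
    obtain r where r: "cbox a b \<subseteq> cball 0 r"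
      using bounded_subset_ballD[OF bounded_cbox] ball_subset_cball by (meson order_trans)
    have A: "derivative_family A" "supported_on (cball 0 r) A"
    proof -
      show "derivative_family A"
        unfolding A_def using bs by (intro derivative_family_tensor_product) (simp add: bump_sequence_def)
      have "supported_on (cbox a b) A" unfolding A_def by (rule supported_on_tensor_product[OF bs])
      then show "supported_on (cball 0 r) A" using r unfolding supported_on_def by blast
    qed
    define E where "E = (\<lambda>k x. A k x *\<^sub>R (axis i 1 :: real^3))"
    have E: "derivative_family E" "supported_on (cball 0 r) E"
      unfolding E_def using A by (auto intro: derivative_family_scaleR_left simp: supported_on_def)
    \<comment> \<open>The correlation at shift 0 is the plain integral against the bump. The
      remaining shifts enter because the harmonic maximum principle lives on the whole
      space.\<close>
    have "correlation (u t) (E (\<lambda>_. 0)) 0 = 0"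
    proof (rule weakly_harmonic_correlation_zero[OF ut E])
      fix y
      let ?S = "solenoidal_field i A (\<lambda>_. 0)"
        and ?L = "\<lambda>x. \<Sum>j\<in>UNIV. E (inc j (inc j (\<lambda>_. 0))) x"
      \<comment> \<open>The gradient to be removed is that of \<partial>_i g, so the family is
        shifted by one index before orthogonality to gradients is applied.\<close>
      have "derivative_family (\<lambda>k. A (inc i k))" "supported_on (cball 0 r) (\<lambda>k. A (inc i k))"
        using A by (auto intro: derivative_family_inc simp: supported_on_def)
      then have "correlation (u t) (\<lambda>x. \<chi> j. A (inc i (inc j (\<lambda>_. 0))) x) y = 0"
        by (rule divergence_free_correlation_gradient[OF assms(3)[OF t]])
      moreover have "(\<chi> j. A (inc i (inc j (\<lambda>_. 0))) x) = ?L x - ?S x" for x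
        using solenoidal_plus_gradient[of i A "\<lambda>_. 0" x]
        by (simp add: E_def scaleR_sum_left inc_commute[of i] algebra_simps)
      ultimately have diff0: "correlation (u t) (\<lambda>x. ?L x - ?S x) y = 0" by simp
      obtain M where M: "bounded_kernel M r ?L"
        using derivative_family_bounded_kernel[OF derivative_family_laplacian[OF E(1)]
            supported_on_laplacian[OF E(2)], of "\<lambda>_. 0"] by blast
      obtain M' where M': "bounded_kernel M' r ?S"
        using derivative_family_bounded_kernel[OF derivative_family_solenoidal_field[OF A(1)]
            supported_on_solenoidal_field[OF A(2)], of i "\<lambda>_. 0"] by blast
      have "correlation (u t) (\<lambda>x. ?L x - ?S x) y = correlation (u t) ?L y - correlation (u t) ?S y"
        unfolding correlation_def inner_diff_right
        by (intro Bochner_Integration.integral_diff correlation_integrable[OF ut M] correlation_integrable[OF ut M'])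
      then show "correlation (u t) ?L y = 0"
        using diff0 weak_heat_correlation_solenoidal[OF assms(2,5) A t] by simp
    qed
    then show "(LINT x|lebesgue. u t x \<bullet>
        (tensor_product (\<lambda>j. interval_bump c (a $ j) (b $ j)) (\<lambda>_. 0) x *\<^sub>R axis i 1)) = 0"
      by (simp add: correlation_def E_def A_def)
  qed
  then have "AE x in lebesgue. \<forall>i. u t x $ i = 0"
    by (simp add: inner_axis AE_all_countable)
  then show "AE x in lebesgue. u t x = 0"
    by eventually_elim (simp add: vec_eq_iff)
qed


end
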